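(* There exist absolute constants $C_0, C_1 > 0$ such that the following holds. Let $m,k,t$ be positive integers with $t \le m$ and $t \geq C_0 \log^2(ek/m)$, and let $A$ be a random $m \times k$ matrix whose columns are independent, each uniformly distributed among the vectors in $\{0,1\}^m$ with exactly $t$ ones. Then with probability at least $1 - \exp(-t)$, the discrepancy of $A$ is at most $C_1 \sqrt{t}$.
   Context: For an $m\times k$ matrix $A$ with rows $v_1,\ldots,v_m$, its discrepancy is $\mathrm{disc}(A) = \min_{\chi \in \{-1,+1\}^k} \max_{j \in [m]} |\langle v_j, \chi \rangle|$. *)

theory Defs
  imports "HOL-Probability.Product_PMF" "Jordan_Normal_Form.Matrix"
begin

unbundle no vec_syntax and no inner_syntax
hide_const (open) Finite_Cartesian_Product.row Finite_Cartesian_Product.vec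

definition sign_vecs :: "nat \<Rightarrow> real vec set" where
  "sign_vecs k = {\<chi> \<in> carrier_vec k. \<forall>i<k. \<chi> $ i \<in> {-1, 1}}"

(* Both Min and Max range over finite sets; the Max is over a nonempty set only when A has
   at least one row. *)
definition disc :: "real mat \<Rightarrow> real" where
  "disc A = Min ((\<lambda>\<chi>. Max ((\<lambda>j. \<bar>row A j \<bullet> \<chi>\<bar>) ` {..<dim_row A})) ` sign_vecs (dim_col A))"

definition binary_vecs :: "nat \<Rightarrow> nat \<Rightarrow> real vec set" where
  "binary_vecs m t =
     {v \<in> carrier_vec m. (\<forall>i<m. v $ i \<in> {0, 1}) \<and> card {i. i < m \<and> v $ i = 1} = t}"

(* The product measure lives on functions nat => real vec; outside {..<k} they take the
   irrelevant default value 0_v. Meaningful for t <= m, when binary_vecs m t is nonempty. *)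
definition random_matrix :: "nat \<Rightarrow> nat \<Rightarrow> nat \<Rightarrow> real mat pmf" where
  "random_matrix m k t =
     map_pmf (\<lambda>c. mat_of_cols m (map c [0..<k]))
       (Pi_pmf {..<k} (0\<^sub>v m) (\<lambda>_. pmf_of_set (binary_vecs m t)))"

lemma finite_vecs_entries:
  assumes "finite S"
  shows "finite {v \<in> carrier_vec n. \<forall>i<n. v $ i \<in> S}"
proof -
  have "{v \<in> carrier_vec n. \<forall>i<n. v $ i \<in> S} \<subseteq> vec n ` (PiE {..<n} (\<lambda>_. S))"
  proof
    fix v assume v: "v \<in> {v \<in> carrier_vec n. \<forall>i<n. v $ i \<in> S}"
    have "v = vec n (restrict (\<lambda>i. v $ i) {..<n})"
      using v by (intro eq_vecI) auto
    moreover have "restrict (\<lambda>i. v $ i) {..<n} \<in> PiE {..<n} (\<lambda>_. S)"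
      using v by auto
    ultimately show "v \<in> vec n ` (PiE {..<n} (\<lambda>_. S))" by blast
  qed
  then show ?thesis
    by (rule finite_subset) (use assms in \<open>auto intro!: finite_imageI finite_PiE\<close>)
qed

lemma finite_sign_vecs: "finite (sign_vecs k)"
  unfolding sign_vecs_def by (rule finite_vecs_entries) simp

lemma sign_vecs_nonempty: "sign_vecs k \<noteq> {}"
proof -
  have "vec k (\<lambda>_. 1) \<in> sign_vecs k" by (auto simp: sign_vecs_def)
  then show ?thesis by blast
qed

lemma finite_binary_vecs: "finite (binary_vecs m t)"
  by (rule finite_subset[OF _ finite_vecs_entries[of "{0, 1}" m]]) (auto simp: binary_vecs_def)

lemma binary_vecs_nonempty:
  assumes "t \<le> m"
  shows "binary_vecs m t \<noteq> {}"
proof -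
  have "{i. i < m \<and> vec m (\<lambda>i. if i < t then 1 else (0::real)) $ i = 1} = {..<t}"
    using assms by (auto split: if_splits)
  then have "vec m (\<lambda>i. if i < t then 1 else (0::real)) \<in> binary_vecs m t"
    by (auto simp: binary_vecs_def)
  then show ?thesis by blast
qed

end

theory Submission
  imports Defs "HOL-Real_Asymp.Real_Asymp"
begin

text \<open>
  If $t$ is bounded, the Beck--Fiala argument gives discrepancy at most $2t$, so let $t$ be large.

  Call the rows of a column set $V$ of size $u \le m$ regular if, for $u \ge m/\sqrt t$, at most
  $u t^{-1/4}$ rows have more than $8 t \sqrt{u/m}$ ones in $V$ and, for $u < m/\sqrt t$, fewer than
  $u$ rows have more than $8 \sqrt t$ ones in $V$. A union bound over $V$ and over the set of heavy
  rows, with a Chernoff bound for the number of ones in the submatrix, shows that all $V$ are regular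
  with probability at least $1 - e^{-t}$. The hypothesis $\log(ek/m) \le \sqrt t$ is what pays for
  the choice of $V$ among $k$ columns.

  For a matrix with this property, a set of $u \le m$ columns is coloured by repeated partial colouring
  in Beck's pigeonhole form, where the few heavy rows get discrepancy exactly $0$ and the others at most
  $32 \sqrt t (u/m)^{1/8}$. Every step removes a tenth of the columns, so these bounds sum to
  $O(\sqrt t)$. Once $u < m/\sqrt t$, floating colours finish with error $16 \sqrt t$.
  Finally, floating colours reduce $k$ columns to at most $m$ fractionally coloured ones at no cost, and
  these are rounded by the bound of linear by hereditary discrepancy
  (Lovasz, Spencer and Vesztergombi).
\<close>

text \<open>The mean number of ones of a row in u columns is u t / m, which passes sqrt t at u = m /
  sqrt t; from there on a threshold larger than 8 sqrt t is forced. The choice 8 t sqrt(u/m) is a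
  compromise. For such u it is at least 8 t^(3/4), so u t^(-1/4) heavy rows gain a Chernoff exponent
  of order u sqrt t, as much as the choice of the columns can cost. Balancing a heavy row exactly
  costs about 2 ln t in the pigeonhole count, and u t^(-1/4) such costs are negligible against u
  once t is large. The factor sqrt(u/m) makes the errors of successive partial colourings geometric;
  a threshold of order t in its place would lose a power of log t.

  For more than m columns the mean itself exceeds t, so partial colouring at full size would lose.
  Floating colours get past this obstacle, but they leave fractional colours, whereas partial
  colouring starts from zero. Regularity concerns all sets of at most m columns and is therefore
  hereditary, which is what the passage to fractional starting points requires.\<close>

section \<open>Columns as sets of rows: sizes and signed sums of rows\<close>

definition row_size :: "('a \<Rightarrow> 'b set) \<Rightarrow> 'a set \<Rightarrow> 'b \<Rightarrow> nat" where
  "row_size S U j = card {i\<in>U. j \<in> S i}"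

definition row_sum :: "('a \<Rightarrow> 'b set) \<Rightarrow> 'a set \<Rightarrow> ('a \<Rightarrow> real) \<Rightarrow> 'b \<Rightarrow> real" where
  "row_sum S U x j = (\<Sum>i\<in>U. of_bool (j \<in> S i) * x i)"

lemma sum_of_bool_row: "finite U \<Longrightarrow> (\<Sum>i\<in>U. of_bool (j \<in> S i)) = real (row_size S U j)"
  by (simp add: row_size_def of_bool_def sum.If_cases Int_def)

lemma abs_row_sum_le:
  assumes U: "finite U" and x: "\<And>i. i \<in> U \<Longrightarrow> \<bar>x i\<bar> \<le> c"
  shows "\<bar>row_sum S U x j\<bar> \<le> c * real (row_size S U j)"
proof -
  have "\<bar>row_sum S U x j\<bar> \<le> (\<Sum>i\<in>U. c * of_bool (j \<in> S i))"
    unfolding row_sum_def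
    by (rule order.trans[OF sum_abs], rule sum_mono) (use x in \<open>auto simp: abs_mult\<close>)
  then show ?thesis unfolding sum_distrib_left[symmetric] sum_of_bool_row[OF U] .
qed

lemma row_size_le: "finite U \<Longrightarrow> row_size S U j \<le> card U"
  unfolding row_size_def by (intro card_mono) auto

text \<open>Double counting of the ones in a submatrix; it turns the known column sums into control
  of the rows.\<close>

lemma sum_row_size:
  assumes "finite U" "finite R"
  shows "(\<Sum>j\<in>R. row_size S U j) = (\<Sum>i\<in>U. card (S i \<inter> R))"
proof -
  have "real (\<Sum>j\<in>R. row_size S U j) = (\<Sum>j\<in>R. \<Sum>i\<in>U. of_bool (j \<in> S i))"
    using assms by (simp only: of_nat_sum sum_of_bool_row)
  also have "\<dots> = (\<Sum>i\<in>U. \<Sum>j\<in>R. of_bool (j \<in> S i))" by (rule sum.swap)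
  also have "\<dots> = real (\<Sum>i\<in>U. card (S i \<inter> R))"
    unfolding of_nat_sum using assms by (intro sum.cong) (auto simp: of_bool_def sum.If_cases Int_def conj_commute)
  finally show ?thesis by linarith
qed

section \<open>Floating colours and rounding\<close>

text \<open>Gaussian elimination: a pivot removes one unknown together with one equation, so
  \<open>card R < card F\<close> survives the induction.\<close>

lemma homogeneous_system_solution:
  fixes a :: "'b \<Rightarrow> 'a \<Rightarrow> real"
  assumes "finite F" "finite R" "card R < card F"
  shows "\<exists>y. (\<exists>i\<in>F. y i \<noteq> 0) \<and> (\<forall>j\<in>R. (\<Sum>i\<in>F. a j i * y i) = 0)"
  using assms(2,1,3)
proof (induction R arbitrary: F a rule: finite_induct)
  case empty
  then have "F \<noteq> {}" by auto
  then show ?case by (intro exI[of _ "\<lambda>_. 1"]) auto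
next
  case (insert r R)
  show ?case
  proof (cases "\<forall>i\<in>F. a r i = 0")
    case True
    from insert.IH[OF insert.prems(1), of a] insert.prems insert.hyps
    obtain y where "\<exists>i\<in>F. y i \<noteq> 0" "\<forall>j\<in>R. (\<Sum>i\<in>F. a j i * y i) = 0"
      by auto
    with True show ?thesis by (intro exI[of _ y]) auto
  next
    case False
    then obtain p where p: "p \<in> F" "a r p \<noteq> 0" by auto
    define b where "b j i = a j i - a j p * a r i / a r p" for j i
    have "card R < card (F - {p})"
      using insert.prems insert.hyps p by (simp add: card_Diff_singleton)
    from insert.IH[OF _ this, of b] insert.prems
    obtain y where y: "\<exists>i\<in>F-{p}. y i \<noteq> 0" "\<forall>j\<in>R. (\<Sum>i\<in>F-{p}. b j i * y i) = 0"
      by auto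
    define s where "s = (\<Sum>i\<in>F-{p}. a r i * y i)"
    \<comment> \<open>The value at the pivot is the one that solves equation \<open>r\<close>; by
      the form of \<open>b\<close>, the other equations then hold as well.\<close>
    define z where "z = y(p := - s / a r p)"
    have split: "(\<Sum>i\<in>F. a j i * z i) = a j p * z p + (\<Sum>i\<in>F-{p}. a j i * y i)" for j
    proof -
      have "(\<Sum>i\<in>F. a j i * z i) = a j p * z p + (\<Sum>i\<in>F-{p}. a j i * z i)"
        by (rule sum.remove) (use p insert.prems in auto)
      also have "(\<Sum>i\<in>F-{p}. a j i * z i) = (\<Sum>i\<in>F-{p}. a j i * y i)"
        by (rule sum.cong) (auto simp: z_def)
      finally show ?thesis .
    qed
    have "(\<Sum>i\<in>F. a j i * z i) = (\<Sum>i\<in>F-{p}. b j i * y i)" for j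
    proof -
      have "(\<Sum>i\<in>F-{p}. b j i * y i) = (\<Sum>i\<in>F-{p}. a j i * y i) - a j p / a r p * s"
        unfolding s_def b_def sum_distrib_left sum_subtractf[symmetric]
        by (rule sum.cong) (auto simp: algebra_simps)
      then show ?thesis unfolding split by (simp add: z_def)
    qed
    moreover have "(\<Sum>i\<in>F. a r i * z i) = 0"
      unfolding split using p by (simp add: z_def s_def)
    moreover have "\<exists>i\<in>F. z i \<noteq> 0"
      using y(1) by (auto simp: z_def)
    ultimately show ?thesis using y(2) by (intro exI[of _ z]) auto
  qed
qed

text \<open>Walk from \<open>x\<close> along a nonzero kernel vector of the rows in
  \<open>R\<close>, and stop when the first coordinate reaches a sign.\<close>

lemma move_to_boundary:
  fixes a :: "'b \<Rightarrow> 'a \<Rightarrow> real" and x :: "'a \<Rightarrow> real"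
  assumes F: "finite F" and R: "finite R" and card: "card R < card F"
    and x: "\<And>i. i \<in> F \<Longrightarrow> \<bar>x i\<bar> < 1"
  shows "\<exists>x'. (\<forall>i. i \<notin> F \<longrightarrow> x' i = x i) \<and> (\<forall>i\<in>F. \<bar>x' i\<bar> \<le> 1) \<and> (\<exists>i\<in>F. \<bar>x' i\<bar> = 1) \<and>
    (\<forall>j\<in>R. (\<Sum>i\<in>F. a j i * x' i) = (\<Sum>i\<in>F. a j i * x i))"
proof -
  obtain y where y: "\<exists>i\<in>F. y i \<noteq> 0" "\<And>j. j \<in> R \<Longrightarrow> (\<Sum>i\<in>F. a j i * y i) = 0"
    using homogeneous_system_solution[OF F R card, of a] by metis
  define Y where "Y = {i\<in>F. y i \<noteq> 0}"
  have Y: "finite Y" "Y \<noteq> {}" using F y by (auto simp: Y_def)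
  \<comment> \<open>The time at which coordinate \<open>i\<close> arrives at
    \<open>sgn (y i)\<close>; it is positive because \<open>x i\<close> starts strictly
    inside.\<close>
  define c where "c i = (1 - sgn (y i) * x i) / \<bar>y i\<bar>" for i
  define l where "l = Min (c ` Y)"
  have c_pos: "c i > 0" if "i \<in> Y" for i
  proof -
    have "\<bar>x i\<bar> < 1" "y i \<noteq> 0" using x that by (auto simp: Y_def)
    then have "sgn (y i) * x i < 1" by (auto simp: sgn_if)
    then show ?thesis using \<open>y i \<noteq> 0\<close> by (auto simp: c_def)
  qed
  have l_in: "l \<in> c ` Y" using Y by (auto simp: l_def)
  have l_le: "l \<le> c i" if "i \<in> Y" for i using that Y by (auto simp: l_def)
  have l_pos: "l > 0" using l_in c_pos by auto
  define x' where "x' i = (if i \<in> F then x i + l * y i else x i)" for i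
  have "\<bar>x' i\<bar> \<le> 1" if "i \<in> F" for i
  proof (cases "y i = 0")
    case True
    then show ?thesis using x[OF that] that by (simp add: x'_def)
  next
    case False
    with that have "l * \<bar>y i\<bar> \<le> 1 - sgn (y i) * x i"
      using l_le[of i] by (simp add: Y_def c_def field_simps)
    moreover have "l * \<bar>y i\<bar> \<ge> 0" using l_pos by simp
    ultimately show ?thesis using x[OF that] that False
      by (auto simp: x'_def sgn_if abs_if split: if_splits)
  qed
  moreover have "\<exists>i\<in>F. \<bar>x' i\<bar> = 1"
  proof -
    obtain i where i: "i \<in> Y" "l = c i" using l_in by auto
    then have "l * \<bar>y i\<bar> = 1 - sgn (y i) * x i" "i \<in> F" "y i \<noteq> 0"
      by (auto simp: c_def Y_def)
    then have "\<bar>x' i\<bar> = 1"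
      by (auto simp: x'_def sgn_if abs_if split: if_splits)
    then show ?thesis using \<open>i \<in> F\<close> by blast
  qed
  moreover have "(\<Sum>i\<in>F. a j i * x' i) = (\<Sum>i\<in>F. a j i * x i)" if "j \<in> R" for j
  proof -
    have "(\<Sum>i\<in>F. a j i * x' i) = (\<Sum>i\<in>F. a j i * x i) + l * (\<Sum>i\<in>F. a j i * y i)"
      unfolding sum_distrib_left sum.distrib[symmetric]
      by (rule sum.cong) (auto simp: x'_def algebra_simps)
    then show ?thesis using y(2)[OF that] by simp
  qed
  ultimately show ?thesis by (intro exI[of _ x']) (auto simp: x'_def)
qed

text \<open>As long as more coordinates float than there are rows, \<open>move_to_boundary\<close>
  freezes another one without changing any row sum.\<close>

lemma floating_colours:
  fixes a :: "'b \<Rightarrow> 'a \<Rightarrow> real" and x :: "'a \<Rightarrow> real"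
  assumes U: "finite U" and R: "finite R" and x: "\<And>i. i \<in> U \<Longrightarrow> \<bar>x i\<bar> \<le> 1"
  shows "\<exists>x'. (\<forall>i\<in>U. \<bar>x' i\<bar> \<le> 1) \<and> card {i\<in>U. \<bar>x' i\<bar> < 1} \<le> card R \<and>
    (\<forall>j\<in>R. (\<Sum>i\<in>U. a j i * x' i) = (\<Sum>i\<in>U. a j i * x i))"
  using x
proof (induction "card {i\<in>U. \<bar>x i\<bar> < 1}" arbitrary: x rule: less_induct)
  case less
  define F where "F = {i\<in>U. \<bar>x i\<bar> < 1}"
  have F: "finite F" "F \<subseteq> U" using U by (auto simp: F_def)
  show ?case
  proof (cases "card F \<le> card R")
    case True
    then show ?thesis using less.prems by (intro exI[of _ x]) (auto simp: F_def)
  next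
    case False
    then have "card R < card F" by simp
    from move_to_boundary[OF F(1) R this, of x a]
    obtain x' where x': "\<And>i. i \<notin> F \<Longrightarrow> x' i = x i" "\<And>i. i \<in> F \<Longrightarrow> \<bar>x' i\<bar> \<le> 1"
      "\<exists>i\<in>F. \<bar>x' i\<bar> = 1" "\<And>j. j \<in> R \<Longrightarrow> (\<Sum>i\<in>F. a j i * x' i) = (\<Sum>i\<in>F. a j i * x i)"
      by (auto simp: F_def)
    have sums: "(\<Sum>i\<in>U. a j i * x' i) = (\<Sum>i\<in>U. a j i * x i)" if "j \<in> R" for j
      unfolding sum.subset_diff[OF F(2) U] using x'(1,4) that by simp
    have "{i\<in>U. \<bar>x' i\<bar> < 1} \<subset> F"
      using x'(1,3) F by (force simp: F_def)
    then have "card {i\<in>U. \<bar>x' i\<bar> < 1} < card F"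
      using F by (intro psubset_card_mono) auto
    moreover have "\<bar>x' i\<bar> \<le> 1" if "i \<in> U" for i
      using x'(1,2) less.prems that by (cases "i \<in> F") auto
    ultimately have "\<exists>x''. (\<forall>i\<in>U. \<bar>x'' i\<bar> \<le> 1) \<and> card {i\<in>U. \<bar>x'' i\<bar> < 1} \<le> card R \<and>
        (\<forall>j\<in>R. (\<Sum>i\<in>U. a j i * x'' i) = (\<Sum>i\<in>U. a j i * x' i))"
      unfolding F_def by (rule less.hyps)
    then obtain x'' where "\<forall>i\<in>U. \<bar>x'' i\<bar> \<le> 1" "card {i\<in>U. \<bar>x'' i\<bar> < 1} \<le> card R"
      "\<forall>j\<in>R. (\<Sum>i\<in>U. a j i * x'' i) = (\<Sum>i\<in>U. a j i * x' i)"
      by blast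
    then show ?thesis using sums by (intro exI[of _ x'']) auto
  qed
qed

text \<open>The Beck-Fiala argument from a fractional start. Rows with more than \<open>s\<close>
  ones among the floating columns are kept exactly, and \<open>few\<close> leaves a free direction.
  A row with at most \<open>s\<close> floating columns is released, since each of these can change
  by at most 2 from then on.\<close>

lemma beck_fiala:
  fixes x :: "'a \<Rightarrow> real"
  assumes U: "finite U" and R: "finite R" and x: "\<And>i. i \<in> U \<Longrightarrow> \<bar>x i\<bar> \<le> 1"
    and few: "\<And>V. V \<subseteq> U \<Longrightarrow> V \<noteq> {} \<Longrightarrow> card {j\<in>R. real (row_size S V j) > s} < card V"
    and s: "s \<ge> 0"
  shows "\<exists>\<chi>. (\<forall>i\<in>U. \<chi> i \<in> {-1, 1}) \<and>
    (\<forall>j\<in>R. \<bar>row_sum S U \<chi> j - row_sum S U x j\<bar> \<le> 2 * s)"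
proof -
  \<comment> \<open>The extra clause, that frozen entries keep their values, confines later changes
    of a released row to the columns floating at its release.\<close>
  have "\<exists>\<chi>. (\<forall>i\<in>U. \<chi> i \<in> {-1, 1} \<and> (\<bar>x i\<bar> = 1 \<longrightarrow> \<chi> i = x i)) \<and>
    (\<forall>j\<in>R. \<bar>row_sum S U \<chi> j - row_sum S U x j\<bar> \<le> 2 * s)"
    using x
  proof (induction "card {i\<in>U. \<bar>x i\<bar> < 1}" arbitrary: x rule: less_induct)
    case less
    define F where "F = {i\<in>U. \<bar>x i\<bar> < 1}"
    have F: "finite F" "F \<subseteq> U" using U by (auto simp: F_def)
    have off: "\<bar>x i\<bar> = 1" if "i \<in> U - F" for i
      using that less.prems[of i] by (auto simp: F_def)
    show ?case
    proof (cases "F = {}")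
      case True
      then have "\<forall>i\<in>U. \<bar>x i\<bar> = 1" using off by auto
      then have "\<forall>i\<in>U. x i \<in> {-1, 1}" by (auto simp: abs_if split: if_splits)
      then show ?thesis using s by (intro exI[of _ x]) auto
    next
      case False
      define B where "B = {j\<in>R. real (row_size S F j) > s}"
      have "card B < card F" "finite B" using few[OF F(2) False] R by (auto simp: B_def)
      moreover have "\<And>i. i \<in> F \<Longrightarrow> \<bar>x i\<bar> < 1" by (simp add: F_def)
      ultimately have "\<exists>x'. (\<forall>i. i \<notin> F \<longrightarrow> x' i = x i) \<and> (\<forall>i\<in>F. \<bar>x' i\<bar> \<le> 1) \<and>
          (\<exists>i\<in>F. \<bar>x' i\<bar> = 1) \<and> (\<forall>j\<in>B. row_sum S F x' j = row_sum S F x j)"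
        unfolding row_sum_def by (intro move_to_boundary[OF F(1)])
      then obtain x' where x': "\<And>i. i \<notin> F \<Longrightarrow> x' i = x i" "\<And>i. i \<in> F \<Longrightarrow> \<bar>x' i\<bar> \<le> 1"
        "\<exists>i\<in>F. \<bar>x' i\<bar> = 1" "\<And>j. j \<in> B \<Longrightarrow> row_sum S F x' j = row_sum S F x j"
        by blast
      have "{i\<in>U. \<bar>x' i\<bar> < 1} \<subset> F"
        using x'(1,3) F by (force simp: F_def)
      then have "card {i\<in>U. \<bar>x' i\<bar> < 1} < card F"
        using F by (intro psubset_card_mono) auto
      from less.hyps[OF this[unfolded F_def]] x'(1,2) less.prems
      obtain \<chi> where \<chi>: "\<And>i. i \<in> U \<Longrightarrow> \<chi> i \<in> {-1, 1}"
        "\<And>i. i \<in> U \<Longrightarrow> \<bar>x' i\<bar> = 1 \<Longrightarrow> \<chi> i = x' i"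
        "\<And>j. j \<in> R \<Longrightarrow> \<bar>row_sum S U \<chi> j - row_sum S U x' j\<bar> \<le> 2 * s"
        by metis
      have \<chi>_off: "\<chi> i = x i" if "i \<in> U - F" for i
        using \<chi>(2)[of i] x'(1)[of i] off[of i] that by auto
      have "\<bar>row_sum S U \<chi> j - row_sum S U x j\<bar> \<le> 2 * s" if j: "j \<in> R" for j
      proof (cases "j \<in> B")
        case True
        have "row_sum S U x' j = row_sum S U x j"
          using x'(1) x'(4)[OF True] unfolding row_sum_def sum.subset_diff[OF F(2) U] by simp
        then show ?thesis using \<chi>(3)[OF j] by simp
      next
        case False
        have "row_sum S U \<chi> j - row_sum S U x j = row_sum S F (\<lambda>i. \<chi> i - x i) j"
          using \<chi>_off unfolding row_sum_def sum.subset_diff[OF F(2) U]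
          by (simp add: sum_subtractf algebra_simps)
        also have "\<bar>\<dots>\<bar> \<le> 2 * real (row_size S F j)"
        proof (rule abs_row_sum_le[OF F(1)])
          fix i assume "i \<in> F"
          then have "\<bar>x i\<bar> < 1" "\<chi> i \<in> {-1, 1}" using \<chi>(1) by (auto simp: F_def)
          then show "\<bar>\<chi> i - x i\<bar> \<le> 2" by auto
        qed
        finally show ?thesis using False j by (simp add: B_def)
      qed
      moreover have "\<chi> i = x i" if "i \<in> U" "\<bar>x i\<bar> = 1" for i
        using \<chi>_off[of i] that by (auto simp: F_def)
      ultimately show ?thesis using \<chi>(1) by (intro exI[of _ \<chi>]) auto
    qed
  qed
  then show ?thesis by blast
qed

text \<open>The binary digits are rounded away from the last one upwards: a signing of the entries with odd
  numerator makes all numerators even.\<close>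

lemma dyadic_rounding:
  fixes a :: "'a \<Rightarrow> nat"
  assumes W: "finite W" and D: "D \<ge> 0"
    and her: "\<And>U. U \<subseteq> W \<Longrightarrow> \<exists>\<chi>. (\<forall>i\<in>U. \<chi> i \<in> {-1, 1}) \<and> (\<forall>j\<in>R. \<bar>row_sum S U \<chi> j\<bar> \<le> D)"
    and a: "\<And>i. i \<in> W \<Longrightarrow> a i \<le> 2 ^ N"
  shows "\<exists>\<chi>. (\<forall>i\<in>W. \<chi> i \<in> {-1, 1}) \<and>
    (\<forall>j\<in>R. \<bar>row_sum S W \<chi> j - row_sum S W (\<lambda>i. 2 * real (a i) / 2 ^ N - 1) j\<bar> \<le> 2 * D * (1 - 1 / 2 ^ N))"
  using a
proof (induction N arbitrary: a)
  case 0
  have "2 * real (a i) - 1 \<in> {-1, 1}" if "i \<in> W" for i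
    using 0[OF that] by (cases "a i") auto
  then show ?case by (intro exI[of _ "\<lambda>i. 2 * real (a i) - 1"]) auto
next
  case (Suc N)
  define U where "U = {i\<in>W. odd (a i)}"
  have U: "finite U" "U \<subseteq> W" using W by (auto simp: U_def)
  obtain \<psi> where \<psi>: "\<And>i. i \<in> U \<Longrightarrow> \<psi> i \<in> {-1, 1}" "\<And>j. j \<in> R \<Longrightarrow> \<bar>row_sum S U \<psi> j\<bar> \<le> D"
    using her[OF U(2)] by blast
  define b where "b i = (if i \<in> U then (if \<psi> i = 1 then a i + 1 else a i - 1) else a i) div 2" for i
  have b: "2 * real (b i) = real (a i) + (if i \<in> U then \<psi> i else 0)" if "i \<in> W" for i
  proof (cases "i \<in> U")
    case True
    then have "odd (a i)" by (auto simp: U_def)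
    then obtain n where "a i = 2 * n + 1" by (rule oddE)
    then show ?thesis using \<psi>(1)[OF True] True by (auto simp: b_def)
  next
    case False
    then have "even (a i)" using that by (auto simp: U_def)
    then show ?thesis using False by (auto simp: b_def elim: evenE)
  qed
  have "b i \<le> 2 ^ N" if "i \<in> W" for i
  proof -
    \<comment> \<open>An odd numerator differs from the even bound \<open>2 ^ Suc N\<close>, so
      rounding it up stays in range.\<close>
    have "a i + 1 \<le> 2 * 2 ^ N" if "i \<in> U"
    proof -
      have "odd (a i)" "a i \<le> 2 * 2 ^ N" using that Suc.prems[of i] by (auto simp: U_def)
      then show ?thesis by (cases "a i = 2 * 2 ^ N") auto
    qed
    then show ?thesis using Suc.prems[OF that] by (auto simp: b_def)
  qed
  then have "\<exists>\<chi>. (\<forall>i\<in>W. \<chi> i \<in> {-1, 1}) \<and>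
    (\<forall>j\<in>R. \<bar>row_sum S W \<chi> j - row_sum S W (\<lambda>i. 2 * real (b i) / 2 ^ N - 1) j\<bar> \<le> 2 * D * (1 - 1 / 2 ^ N))"
    by (rule Suc.IH)
  then obtain \<chi> where \<chi>: "\<forall>i\<in>W. \<chi> i \<in> {-1, 1}"
    "\<forall>j\<in>R. \<bar>row_sum S W \<chi> j - row_sum S W (\<lambda>i. 2 * real (b i) / 2 ^ N - 1) j\<bar> \<le> 2 * D * (1 - 1 / 2 ^ N)"
    by blast
  have "\<bar>row_sum S W \<chi> j - row_sum S W (\<lambda>i. 2 * real (a i) / 2 ^ Suc N - 1) j\<bar> \<le> 2 * D * (1 - 1 / 2 ^ Suc N)"
    if j: "j \<in> R" for j
  proof -
    \<comment> \<open>Replacing the numerators \<open>a\<close> by \<open>b\<close> moves the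
      colours by \<open>\<psi> i / 2 ^ N\<close> on \<open>U\<close>, at a cost of at most
      \<open>D / 2 ^ N\<close> per row; over all digits these costs form a geometric series below
      \<open>2 * D\<close>.\<close>
    have "row_sum S W (\<lambda>i. 2 * real (b i) / 2 ^ N - 1) j =
      (\<Sum>i\<in>W. of_bool (j \<in> S i) * (2 * real (a i) / 2 ^ Suc N - 1) + (if i \<in> U then of_bool (j \<in> S i) * \<psi> i / 2 ^ N else 0))"
      unfolding row_sum_def
    proof (rule sum.cong)
      fix i assume "i \<in> W"
      then show "of_bool (j \<in> S i) * (2 * real (b i) / 2 ^ N - 1) =
        of_bool (j \<in> S i) * (2 * real (a i) / 2 ^ Suc N - 1) + (if i \<in> U then of_bool (j \<in> S i) * \<psi> i / 2 ^ N else 0)"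
        unfolding b[OF \<open>i \<in> W\<close>] by (simp add: field_simps)
    qed simp
    also have "\<dots> = row_sum S W (\<lambda>i. 2 * real (a i) / 2 ^ Suc N - 1) j + row_sum S U \<psi> j / 2 ^ N"
      using W U by (simp add: sum.distrib row_sum_def sum.If_cases Int_absorb1 sum_divide_distrib
          del: sum_of_bool_mult_eq)
    finally have "\<bar>row_sum S W \<chi> j - row_sum S W (\<lambda>i. 2 * real (a i) / 2 ^ Suc N - 1) j\<bar> \<le>
      2 * D * (1 - 1 / 2 ^ N) + \<bar>row_sum S U \<psi> j / 2 ^ N\<bar>"
      using bspec[OF \<chi>(2) j] by linarith
    also have "\<bar>row_sum S U \<psi> j / 2 ^ N\<bar> \<le> D / 2 ^ N"
      using \<psi>(2)[OF j] by (simp add: divide_right_mono)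
    finally show ?thesis by (simp add: field_simps)
  qed
  then show ?case using \<chi>(1) by blast
qed

text \<open>Truncation to dyadic colours. With \<open>2 * card W < 2 ^ N\<close> it changes a row
  sum by at most 1, which is the additive term.\<close>

lemma linear_discrepancy_le_hereditary:
  fixes x :: "'a \<Rightarrow> real"
  assumes W: "finite W" and D: "D \<ge> 0"
    and her: "\<And>U. U \<subseteq> W \<Longrightarrow> \<exists>\<chi>. (\<forall>i\<in>U. \<chi> i \<in> {-1, 1}) \<and> (\<forall>j\<in>R. \<bar>row_sum S U \<chi> j\<bar> \<le> D)"
    and x: "\<And>i. i \<in> W \<Longrightarrow> \<bar>x i\<bar> \<le> 1"
  shows "\<exists>\<chi>. (\<forall>i\<in>W. \<chi> i \<in> {-1, 1}) \<and> (\<forall>j\<in>R. \<bar>row_sum S W \<chi> j - row_sum S W x j\<bar> \<le> 2 * D + 1)"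
proof -
  obtain N where N: "2 * real (card W) < 2 ^ N"
    using real_arch_pow[of 2 "2 * real (card W)"] by auto
  define a where "a i = nat \<lfloor>2 ^ N * (x i + 1) / 2\<rfloor>" for i
  have a: "a i \<le> 2 ^ N" "\<bar>(2 * real (a i) / 2 ^ N - 1) - x i\<bar> \<le> 2 / 2 ^ N" if "i \<in> W" for i
  proof -
    define z where "z = 2 ^ N * (x i + 1) / 2"
    have "\<bar>x i\<bar> \<le> 1" using x[OF that] .
    then have "0 \<le> z" "z \<le> 2 ^ N" by (auto simp: z_def)
    then have az: "real (a i) \<le> z" "z < real (a i) + 1" unfolding a_def z_def[symmetric] by linarith+
    then have "real (a i) \<le> 2 ^ N" using \<open>z \<le> 2 ^ N\<close> by linarith
    then show "a i \<le> 2 ^ N" by (metis of_nat_le_iff of_nat_numeral of_nat_power)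
    have "x i = 2 * z / 2 ^ N - 1" by (simp add: z_def)
    then have "(2 * real (a i) / 2 ^ N - 1) - x i = 2 * (real (a i) - z) / 2 ^ N"
      by (simp add: diff_divide_distrib)
    also have "\<bar>\<dots>\<bar> \<le> 2 / 2 ^ N" using az by (simp add: divide_right_mono abs_mult)
    finally show "\<bar>(2 * real (a i) / 2 ^ N - 1) - x i\<bar> \<le> 2 / 2 ^ N" .
  qed
  have "\<exists>\<chi>. (\<forall>i\<in>W. \<chi> i \<in> {-1, 1}) \<and>
    (\<forall>j\<in>R. \<bar>row_sum S W \<chi> j - row_sum S W (\<lambda>i. 2 * real (a i) / 2 ^ N - 1) j\<bar> \<le> 2 * D * (1 - 1 / 2 ^ N))"
    using W D her a(1) by (rule dyadic_rounding)
  then obtain \<chi> where \<chi>: "\<forall>i\<in>W. \<chi> i \<in> {-1, 1}"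
    "\<forall>j\<in>R. \<bar>row_sum S W \<chi> j - row_sum S W (\<lambda>i. 2 * real (a i) / 2 ^ N - 1) j\<bar> \<le> 2 * D * (1 - 1 / 2 ^ N)"
    by blast
  have "\<bar>row_sum S W \<chi> j - row_sum S W x j\<bar> \<le> 2 * D + 1" if "j \<in> R" for j
  proof -
    have "\<bar>row_sum S W (\<lambda>i. (2 * real (a i) / 2 ^ N - 1) - x i) j\<bar> \<le> 2 / 2 ^ N * real (row_size S W j)"
      by (rule abs_row_sum_le[OF W a(2)])
    also have "\<dots> \<le> 2 / 2 ^ N * real (card W)"
      by (intro mult_left_mono) (auto simp: row_size_le[OF W])
    also have "\<dots> \<le> 1" using N by (simp add: field_simps)
    finally have "\<bar>row_sum S W (\<lambda>i. 2 * real (a i) / 2 ^ N - 1) j - row_sum S W x j\<bar> \<le> 1"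
      by (simp add: row_sum_def sum_subtractf sum.distrib algebra_simps)
    moreover have "2 * D * (1 - 1 / 2 ^ N) \<le> 2 * D" using D by (simp add: mult_left_le)
    ultimately show ?thesis using bspec[OF \<chi>(2) that] by linarith
  qed
  then show ?thesis using \<chi>(1) by blast
qed

section \<open>Partial colouring\<close>

text \<open>The moment generating function of a random sign, with \<open>x\<^sup>2\<close> in place
  of the sharp \<open>x\<^sup>2 / 2\<close>. Up to 1, both exponentials are compared with quadratic
  polynomials whose linear terms cancel; beyond 1, already \<open>x \<le> x\<^sup>2\<close>.\<close>

lemma exp_plus_exp_minus_le: "exp x + exp (- x) \<le> 2 * exp (x\<^sup>2)" for x :: real
proof -
  have *: "exp x + exp (- x) \<le> 2 * exp (x\<^sup>2)" if "x \<ge> 0" for x :: real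
  proof (cases "x \<le> 1")
    case True
    have "exp (- x) \<le> 1 - x + x\<^sup>2"
    proof -
      have "1 + x + x\<^sup>2 / 2 \<le> exp x" using that by (rule exp_lower_Taylor_quadratic)
      have pos: "1 - x + x\<^sup>2 \<ge> 0" using True by simp
      have "1 \<le> 1 + x\<^sup>2 / 2 + x ^ 3 / 2 + x ^ 4 / 2" using that by simp
      also have "\<dots> = (1 - x + x\<^sup>2) * (1 + x + x\<^sup>2 / 2)"
        by (simp add: field_simps power2_eq_square power3_eq_cube power4_eq_xxxx)
      also have "\<dots> \<le> (1 - x + x\<^sup>2) * exp x"
        using pos by (rule mult_left_mono[rotated]) fact
      finally show ?thesis by (simp add: exp_minus field_simps)
    qed
    moreover have "exp x \<le> 1 + x + x\<^sup>2" using that True by (rule exp_bound)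
    moreover have "1 + x\<^sup>2 \<le> exp (x\<^sup>2)" by (rule exp_ge_add_one_self)
    ultimately show ?thesis by linarith
  next
    case False
    then have "x \<le> x\<^sup>2" by (simp add: power2_eq_square)
    then have "exp x \<le> exp (x\<^sup>2)" by simp
    moreover have "exp (- x) \<le> exp x" using that by simp
    ultimately show ?thesis by linarith
  qed
  show ?thesis using *[of x] *[of "- x"] by (cases "x \<ge> 0") (auto simp: add.commute)
qed

abbreviation signings :: "'a set \<Rightarrow> ('a \<Rightarrow> real) set" where
  "signings U \<equiv> PiE U (\<lambda>_. {-1, 1})"

lemma card_signings: "finite U \<Longrightarrow> card (signings U) = 2 ^ card U"
  by (subst card_PiE) (auto simp: numeral_2_eq_2)

text \<open>Means over uniform signings are written as sums over \<open>signings U\<close>;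
  independence of the signs is the exchange of product and sum.\<close>

lemma sum_exp_row_sum_le:
  assumes U: "finite U"
  shows "(\<Sum>\<chi>\<in>signings U. exp (h * row_sum S U \<chi> j)) \<le> 2 ^ card U * exp (h\<^sup>2 * real (row_size S U j))"
proof -
  have "(\<Sum>\<chi>\<in>signings U. exp (h * row_sum S U \<chi> j)) = (\<Sum>\<chi>\<in>signings U. \<Prod>i\<in>U. exp (h * of_bool (j \<in> S i) * \<chi> i))"
    by (rule sum.cong[OF refl], simp only: row_sum_def sum_distrib_left exp_sum[OF U] mult.assoc)
  also have "\<dots> = (\<Prod>i\<in>U. \<Sum>b\<in>{-1, 1}. exp (h * of_bool (j \<in> S i) * b))"
    using U by (subst prod_sum_PiE) auto
  also have "\<dots> \<le> (\<Prod>i\<in>U. 2 * exp (h\<^sup>2 * of_bool (j \<in> S i)))"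
  proof (rule prod_mono, safe)
    fix i
    show "(\<Sum>b\<in>{-1, 1}. exp (h * of_bool (j \<in> S i) * b)) \<le> 2 * exp (h\<^sup>2 * of_bool (j \<in> S i))"
      using exp_plus_exp_minus_le[of h] by (cases "j \<in> S i") (auto simp: add.commute)
  qed (auto intro!: sum_nonneg)
  also have "\<dots> = 2 ^ card U * exp (h\<^sup>2 * real (row_size S U j))"
    using U by (simp only: prod.distrib prod_constant exp_sum[symmetric] sum_distrib_left[symmetric] sum_of_bool_row)
  finally show ?thesis .
qed

text \<open>Bounds the bucket number of a row sum by an exponential, whose mean over all signings factorises.\<close>

lemma abs_round_le_exp:
  fixes x c :: real
  assumes c: "c \<ge> 1"
  shows "\<bar>real_of_int (round (x / 2))\<bar> \<le> exp (c * \<bar>x\<bar> - c + 1)"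
proof (cases "round (x / 2) = 0")
  case True
  then show ?thesis by simp
next
  case False
  then have "\<bar>real_of_int (round (x / 2))\<bar> \<ge> 1" by linarith
  moreover have "\<bar>real_of_int (round (x / 2)) - x / 2\<bar> \<le> 1 / 2"
    using of_int_round_abs_le[of "x / 2"] by simp
  ultimately have x: "\<bar>x\<bar> \<ge> 1" "\<bar>real_of_int (round (x / 2))\<bar> \<le> \<bar>x\<bar>" by linarith+
  have "1 * (\<bar>x\<bar> - 1) \<le> c * (\<bar>x\<bar> - 1)" using c x by (intro mult_right_mono) auto
  then have "\<bar>x\<bar> \<le> 1 + (c * \<bar>x\<bar> - c + 1)" by (simp add: algebra_simps)
  also have "\<dots> \<le> exp (c * \<bar>x\<bar> - c + 1)" by (rule exp_ge_add_one_self)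
  finally show ?thesis using x by linarith
qed

text \<open>The mean bucket number is exponentially small in \<open>l\<close>: a nonzero bucket
  needs a row sum of at least \<open>sqrt (8 * l * s)\<close> in absolute value.\<close>

lemma sum_abs_round_row_sum_le:
  assumes U: "finite U" and l: "l \<ge> 1" and s: "s > 0" "real (row_size S U j) \<le> s"
  shows "(\<Sum>\<chi>\<in>signings U. \<bar>real_of_int (round (row_sum S U \<chi> j / sqrt (8 * l * s) / 2))\<bar>)
    \<le> 2 ^ card U * (2 * exp (1 - 2 * l))"
proof -
  define \<Delta> where "\<Delta> = sqrt (8 * l * s)"
  \<comment> \<open>The minimiser of \<open>h\<^sup>2 * s - h * \<Delta>\<close>; it gives
    \<open>h\<^sup>2 * s = 2 * l\<close> and \<open>h * \<Delta> = 4 * l\<close>.\<close>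
  define h where "h = 4 * l / \<Delta>"
  have \<Delta>: "\<Delta> > 0" "\<Delta>\<^sup>2 = 8 * l * s" using l s by (auto simp: \<Delta>_def)
  have "h\<^sup>2 * real (row_size S U j) \<le> h\<^sup>2 * s" using s by (intro mult_left_mono) auto
  also have "\<dots> = 2 * l" unfolding h_def power_divide \<Delta>(2) using l s by (simp add: power2_eq_square)
  finally have h: "h\<^sup>2 * real (row_size S U j) \<le> 2 * l" .
  have "(\<Sum>\<chi>\<in>signings U. \<bar>real_of_int (round (row_sum S U \<chi> j / \<Delta> / 2))\<bar>) \<le>
    (\<Sum>\<chi>\<in>signings U. exp (1 - 4 * l) * (exp (h * row_sum S U \<chi> j) + exp (- h * row_sum S U \<chi> j)))"
  proof (rule sum_mono)
    fix \<chi>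
    define X where "X = row_sum S U \<chi> j"
    have "\<bar>real_of_int (round (X / \<Delta> / 2))\<bar> \<le> exp (4 * l * \<bar>X / \<Delta>\<bar> - 4 * l + 1)"
      using l by (intro abs_round_le_exp) auto
    also have "4 * l * \<bar>X / \<Delta>\<bar> - 4 * l + 1 = (1 - 4 * l) + h * \<bar>X\<bar>"
      using \<Delta> by (simp add: h_def)
    also have "exp ((1 - 4 * l) + h * \<bar>X\<bar>) \<le> exp (1 - 4 * l) * (exp (h * X) + exp (- h * X))"
      unfolding exp_add by (intro mult_left_mono) (auto simp: abs_if)
    finally show "\<bar>real_of_int (round (row_sum S U \<chi> j / \<Delta> / 2))\<bar> \<le>
      exp (1 - 4 * l) * (exp (h * row_sum S U \<chi> j) + exp (- h * row_sum S U \<chi> j))"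
      by (simp only: X_def)
  qed
  also have "\<dots> = exp (1 - 4 * l) * ((\<Sum>\<chi>\<in>signings U. exp (h * row_sum S U \<chi> j)) + (\<Sum>\<chi>\<in>signings U. exp (- h * row_sum S U \<chi> j)))"
    by (simp only: sum_distrib_left[symmetric] sum.distrib)
  also have "\<dots> \<le> exp (1 - 4 * l) * (2 ^ card U * exp (2 * l) + 2 ^ card U * exp (2 * l))"
    using h sum_exp_row_sum_le[OF U, of h S j] sum_exp_row_sum_le[OF U, of "- h" S j]
    by (intro mult_left_mono add_mono) (auto elim!: order.trans)
  also have "\<dots> = 2 ^ card U * (2 * (exp (1 - 4 * l) * exp (2 * l)))"
    by (simp add: algebra_simps)
  also have "exp (1 - 4 * l) * exp (2 * l) = exp (1 - 2 * l)"
    by (simp add: exp_add[symmetric])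
  finally show ?thesis unfolding \<Delta>_def .
qed

text \<open>A two-sided geometric series with ratio q = exp(-l): 1 + 2q/(1-q) \<le> 1 + 4q for q
  \<le> 1/2. It is the weighted count of the buckets of one row.\<close>

lemma sum_exp_abs_le:
  fixes B :: "int set"
  assumes B: "finite B" and q: "exp (- l) \<le> 1 / 2"
  shows "(\<Sum>b\<in>B. exp (- l * \<bar>real_of_int b\<bar>)) \<le> 1 + 4 * exp (- l)"
proof -
  define q where "q = exp (- l)"
  have q': "q > 0" "q \<le> 1 / 2" using q by (auto simp: q_def)
  have pow: "exp (- l * real n) = q ^ n" for n
    by (simp add: q_def exp_of_nat_mult[symmetric] mult.commute)
  \<comment> \<open>The subtracted term is the slack that carries the induction:
    \<open>2 * q ^ Suc n + 4 * q ^ Suc (Suc n) \<le> 4 * q ^ Suc n\<close>.\<close>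
  have seg: "(\<Sum>b\<in>{- int n..int n}. exp (- l * \<bar>real_of_int b\<bar>)) \<le> 1 + 4 * q - 4 * q ^ Suc n" for n
  proof (induction n)
    case (Suc n)
    have "{- int (Suc n)..int (Suc n)} = insert (int (Suc n)) (insert (- int (Suc n)) {- int n..int n})"
      by auto
    then have "(\<Sum>b\<in>{- int (Suc n)..int (Suc n)}. exp (- l * \<bar>real_of_int b\<bar>)) =
      2 * exp (- l * real (Suc n)) + (\<Sum>b\<in>{- int n..int n}. exp (- l * \<bar>real_of_int b\<bar>))"
      by (simp add: add.commute)
    also have "\<dots> \<le> 2 * q ^ Suc n + (1 + 4 * q - 4 * q ^ Suc n)"
      using Suc.IH by (simp only: pow)
    also have "\<dots> \<le> 1 + 4 * q - 4 * q ^ Suc (Suc n)"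
      using q' mult_right_mono[of q "1 / 2" "q ^ Suc n"] by simp
    finally show ?case .
  qed simp
  obtain n where n: "\<And>b. b \<in> B \<Longrightarrow> \<bar>b\<bar> \<le> int n"
  proof -
    have "\<bar>b\<bar> \<le> int (nat (\<Sum>b\<in>B. \<bar>b\<bar>))" if "b \<in> B" for b
      using member_le_sum[of b B "\<lambda>b. \<bar>b\<bar>"] that B by (simp add: sum_nonneg)
    then show ?thesis using that by blast
  qed
  have "(\<Sum>b\<in>B. exp (- l * \<bar>real_of_int b\<bar>)) \<le> (\<Sum>b\<in>{- int n..int n}. exp (- l * \<bar>real_of_int b\<bar>))"
    using n by (intro sum_mono2) (auto simp: abs_le_iff minus_le_iff)
  also have "\<dots> \<le> 1 + 4 * q - 4 * q ^ Suc n" by (rule seg)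
  also have "\<dots> \<le> 1 + 4 * q" using q' by simp
  finally show ?thesis by (simp add: q_def)
qed

text \<open>Weight a signing at distance d from \<open>\<chi>\<close> by exp(-2d). Points of the
  ball weigh at least exp(-u/5), all signings together \<open>(1 + exp (-2)) ^ card U\<close>, at
  most exp(u/7), and 1/5 + 1/7 < 0.35.\<close>

lemma card_hamming_ball_le:
  assumes U: "finite U" and \<chi>: "\<chi> \<in> signings U"
  shows "real (card {\<psi>\<in>signings U. real (card {i\<in>U. \<psi> i \<noteq> \<chi> i}) \<le> real (card U) / 10}) \<le> exp (0.35 * real (card U))"
proof -
  define u where "u = real (card U)"
  define A where "A = {\<psi>\<in>signings U. real (card {i\<in>U. \<psi> i \<noteq> \<chi> i}) \<le> u / 10}"
  have fin: "finite (signings U)" using U by (intro finite_PiE) auto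
  have "(7::real) \<le> (1 + 1 / 4 + (1 / 4)\<^sup>2 / 2) ^ 8" by (simp add: power_numeral_reduce)
  also have "\<dots> \<le> exp (1 / 4) ^ 8"
    by (intro power_mono exp_lower_Taylor_quadratic) auto
  also have "\<dots> = (exp 2 :: real)" by (simp add: exp_of_nat_mult[symmetric])
  finally have "(7::real) \<le> exp 2" .
  then have e2: "exp (-2) \<le> (1 / 7 :: real)" by (simp add: exp_minus field_simps)
  have "real (card A) * exp (- u / 5) = (\<Sum>\<psi>\<in>A. exp (- u / 5))" by simp
  also have "\<dots> \<le> (\<Sum>\<psi>\<in>A. exp (- 2 * real (card {i\<in>U. \<psi> i \<noteq> \<chi> i})))"
    by (intro sum_mono) (auto simp: A_def)
  also have "\<dots> \<le> (\<Sum>\<psi>\<in>signings U. exp (- 2 * real (card {i\<in>U. \<psi> i \<noteq> \<chi> i})))"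
    using fin by (intro sum_mono2) (auto simp: A_def)
  also have "\<dots> = (\<Sum>\<psi>\<in>signings U. \<Prod>i\<in>U. if \<psi> i \<noteq> \<chi> i then exp (-2) else 1)"
    using U by (intro sum.cong) (auto simp: prod.If_cases Int_def exp_of_nat_mult[symmetric] mult.commute)
  also have "\<dots> = (\<Prod>i\<in>U. \<Sum>b\<in>{-1, 1}. if b \<noteq> \<chi> i then exp (-2) else 1)"
    using U by (subst prod_sum_PiE) auto
  also have "\<dots> = (\<Prod>i\<in>U. 1 + exp (-2))"
  proof (rule prod.cong)
    fix i assume "i \<in> U"
    then have "\<chi> i = -1 \<or> \<chi> i = 1" using \<chi> by auto
    then show "(\<Sum>b\<in>{-1, 1}. if b \<noteq> \<chi> i then exp (-2) else 1) = 1 + exp (-2)" by auto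
  qed simp
  also have "\<dots> \<le> (\<Prod>i\<in>U. exp (1 / 7))"
    using e2 exp_ge_add_one_self[of "1/7"] by (intro prod_mono) (auto intro: add_nonneg_nonneg)
  also have "\<dots> = exp (u / 7)" by (simp add: u_def exp_of_nat_mult[symmetric])
  finally have "real (card A) \<le> exp (u / 7) / exp (- u / 5)" by (simp add: field_simps)
  also have "\<dots> = exp (u / 7 + u / 5)" by (simp add: exp_diff[symmetric])
  also have "\<dots> \<le> exp (0.35 * u)" by (simp add: u_def)
  finally show ?thesis by (simp add: A_def u_def)
qed

text \<open>Half the difference of two signings with equal codes is a partial colouring. With u =
  \<open>card U\<close>, at least half of the 2^u signings have a code of small weight, these codes
  number at most exp(0.145 u), and a Hamming ball of radius u/10 has at most exp(0.35 u) points. As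
  0.495 < ln 2, some code belongs to two signings more than u/10 apart.\<close>

lemma partial_colouring:
  assumes U: "finite U" "card U \<ge> 10" and R: "finite R" "B \<subseteq> R" and l: "l \<ge> 1" and s: "s > 0"
    and size: "\<And>j. j \<in> R - B \<Longrightarrow> real (row_size S U j) \<le> s"
    and few: "real (card R) * exp (- l) \<le> real (card U) / 160"
    and bad: "(\<Sum>j\<in>B. ln (2 * real (row_size S U j) + 1)) \<le> real (card U) / 20"
  shows "\<exists>y. (\<forall>i\<in>U. y i \<in> {-1, 0, 1}) \<and> real (card {i\<in>U. y i \<noteq> 0}) \<ge> real (card U) / 10 \<and>
    (\<forall>j\<in>R-B. \<bar>row_sum S U y j\<bar> \<le> sqrt (8 * l * s)) \<and> (\<forall>j\<in>B. row_sum S U y j = 0)"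
proof -
  define u where "u = real (card U)"
  define G where "G = R - B"
  have fin: "finite G" "finite B" "finite (signings U)"
    using R U by (auto simp: G_def intro: finite_subset intro!: finite_PiE)
  define \<Delta> where "\<Delta> = sqrt (8 * l * s)"
  have \<Delta>: "\<Delta> > 0" using l s by (simp add: \<Delta>_def)
  \<comment> \<open>Bucket of the row sum for light rows; exact (integral) row sum for rows in \<^term>\<open>B\<close>.\<close>
  define code where "code \<chi> j =
    (if j \<in> G then round (row_sum S U \<chi> j / \<Delta> / 2) else \<lfloor>row_sum S U \<chi> j\<rfloor>)" for \<chi> j
  \<comment> \<open>A weight in place of entropy: the codes of weight at most
    \<open>0.07 * u\<close> number at most \<open>exp (0.07 * u)\<close> times the sum of
    \<open>exp (- W f)\<close> over all codes, and that sum factorises over the rows.\<close>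
  define W where "W f = (\<Sum>j\<in>G. l * \<bar>real_of_int (f j)\<bar>)" for f :: "_ \<Rightarrow> int"
  define T where "T = {\<chi>\<in>signings U. W (code \<chi>) \<le> 0.07 * u}"
  define C where "C = (\<lambda>\<chi>. restrict (code \<chi>) R) ` T"
  define Q where "Q j = (\<lambda>\<chi>. code \<chi> j) ` signings U" for j

  have u: "u \<ge> 10" using U by (simp add: u_def)
  have "exp l \<ge> 2" using exp_ge_add_one_self[of l] l by linarith
  then have exp_l: "exp (- l) \<le> 1 / 2" by (simp add: exp_minus field_simps)

  have "real (card G) * exp (- l) \<le> real (card R) * exp (- l)"
    using R by (intro mult_right_mono) (auto simp: G_def intro: card_mono)
  then have G_few: "real (card G) * exp (- l) \<le> u / 160"
    using few unfolding u_def by (rule order.trans)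

  \<comment> \<open>Markov's inequality: the mean weight is at most \<open>0.035 * u\<close>, half
    of the bound in \<open>T\<close>.\<close>
  have card_T: "2 ^ card U / 2 \<le> real (card T)"
  proof -
    have "(\<Sum>\<chi>\<in>signings U. W (code \<chi>)) = (\<Sum>j\<in>G. l * (\<Sum>\<chi>\<in>signings U. \<bar>real_of_int (round (row_sum S U \<chi> j / \<Delta> / 2))\<bar>))"
      unfolding W_def sum_distrib_left by (subst sum.swap) (auto simp: code_def)
    also have "\<dots> \<le> (\<Sum>j\<in>G. l * (2 ^ card U * (2 * exp (1 - 2 * l))))"
      unfolding \<Delta>_def using l s size U
      by (intro sum_mono mult_left_mono sum_abs_round_row_sum_le) (auto simp: G_def)
    also have "\<dots> = 2 ^ card U * (2 * exp 1 * (real (card G) * exp (- l)) * (l * exp (- l)))"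
      by (simp add: exp_diff exp_minus field_simps exp_add[symmetric])
    \<comment> \<open>Of the two factors \<open>exp (- l)\<close>, one beats the number of rows
      through \<open>few\<close>, the other beats the weight \<open>l\<close>.\<close>
    also have "\<dots> \<le> 2 ^ card U * (2 * 2.72 * (u / 160) * 1)"
    proof (intro mult_left_mono mult_mono)
      show "exp 1 \<le> (2.72::real)" using e_less_272 by simp
      show "real (card G) * exp (- l) \<le> u / 160" by (rule G_few)
      have "l \<le> exp l" using exp_ge_add_one_self[of l] by linarith
      then show "l * exp (- l) \<le> 1" by (simp add: exp_minus field_simps)
    qed (use l u in auto)
    also have "\<dots> \<le> 2 ^ card U * (0.035 * u)" using u by (intro mult_left_mono) auto
    finally have total: "(\<Sum>\<chi>\<in>signings U. W (code \<chi>)) \<le> 2 ^ card U * (0.035 * u)" .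
    have "real (card (signings U - T)) * (0.07 * u) = (\<Sum>\<chi>\<in>signings U - T. 0.07 * u)" by simp
    also have "\<dots> \<le> (\<Sum>\<chi>\<in>signings U - T. W (code \<chi>))"
      by (intro sum_mono) (auto simp: T_def)
    also have "\<dots> \<le> (\<Sum>\<chi>\<in>signings U. W (code \<chi>))"
      using fin l by (intro sum_mono2) (auto simp: W_def intro!: sum_nonneg)
    finally have "real (card (signings U - T)) * (0.07 * u) \<le> 2 ^ card U * (0.035 * u)"
      using total by linarith
    then have "real (card (signings U - T)) \<le> 2 ^ card U / 2" using u by (simp add: field_simps)
    moreover have "card (signings U - T) = 2 ^ card U - card T" "card T \<le> 2 ^ card U"
      using card_Diff_subset[of T "signings U"] card_mono[of "signings U" T] fin U(1)
      by (auto simp: T_def card_signings)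
    ultimately show ?thesis by (simp add: of_nat_diff)
  qed

  have card_C: "real (card C) \<le> exp (0.145 * u)"
  proof -
    have finQ: "finite (Q j)" for j using fin by (simp add: Q_def)
    have finE: "finite (PiE R Q)" using R finQ by (intro finite_PiE)
    have finEW: "finite {f\<in>PiE R Q. W f \<le> 0.07 * u}" by (rule finite_subset[OF _ finE]) blast
    have "C \<subseteq> {f\<in>PiE R Q. W f \<le> 0.07 * u}"
    proof
      fix f assume "f \<in> C"
      then obtain \<chi> where \<chi>: "\<chi> \<in> T" "f = restrict (code \<chi>) R" by (auto simp: C_def)
      then have "W f = W (code \<chi>)" by (auto simp: W_def G_def intro!: sum.cong)
      moreover have "f \<in> PiE R Q" using \<chi> by (auto simp: Q_def T_def)
      ultimately show "f \<in> {f\<in>PiE R Q. W f \<le> 0.07 * u}" using \<chi> by (simp add: T_def)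
    qed
    then have "real (card C) \<le> real (card {f\<in>PiE R Q. W f \<le> 0.07 * u})"
      using finEW by (intro of_nat_mono card_mono)
    also have "\<dots> = (\<Sum>f\<in>{f\<in>PiE R Q. W f \<le> 0.07 * u}. 1)" by simp
    also have "\<dots> \<le> (\<Sum>f\<in>{f\<in>PiE R Q. W f \<le> 0.07 * u}. exp (0.07 * u - W f))"
      by (intro sum_mono) auto
    also have "\<dots> \<le> (\<Sum>f\<in>PiE R Q. exp (0.07 * u - W f))"
      using finE by (intro sum_mono2) auto
    also have "\<dots> = exp (0.07 * u) * (\<Sum>f\<in>PiE R Q. \<Prod>j\<in>R. if j \<in> G then exp (- l * \<bar>real_of_int (f j)\<bar>) else 1)"
      unfolding sum_distrib_left
    proof (rule sum.cong[OF refl])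
      fix f
      have "exp (- W f) = (\<Prod>j\<in>G. exp (- l * \<bar>real_of_int (f j)\<bar>))"
        using fin by (simp add: W_def exp_sum[symmetric] sum_negf)
      also have "\<dots> = (\<Prod>j\<in>R. if j \<in> G then exp (- l * \<bar>real_of_int (f j)\<bar>) else 1)"
        using R by (intro prod.mono_neutral_cong_left) (auto simp: G_def)
      finally have "exp (- W f) = (\<Prod>j\<in>R. if j \<in> G then exp (- l * \<bar>real_of_int (f j)\<bar>) else 1)" .
      then show "exp (0.07 * u - W f) = exp (0.07 * u) * (\<Prod>j\<in>R. if j \<in> G then exp (- l * \<bar>real_of_int (f j)\<bar>) else 1)"
        using exp_add[of "0.07 * u" "- W f"] by (simp only: diff_conv_add_uminus)
    qed
    also have "(\<Sum>f\<in>PiE R Q. \<Prod>j\<in>R. if j \<in> G then exp (- l * \<bar>real_of_int (f j)\<bar>) else 1) =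
      (\<Prod>j\<in>R. \<Sum>b\<in>Q j. if j \<in> G then exp (- l * \<bar>real_of_int b\<bar>) else 1)"
      using R finQ by (subst prod_sum_PiE) auto
    also have "\<dots> = (\<Prod>j\<in>G. \<Sum>b\<in>Q j. exp (- l * \<bar>real_of_int b\<bar>)) * (\<Prod>j\<in>B. real (card (Q j)))"
    proof -
      have "R - G = B" using R by (auto simp: G_def)
      then show ?thesis using R by (subst prod.subset_diff[of G R]) (auto simp: G_def)
    qed
    \<comment> \<open>A light row costs \<open>4 * exp (- l)\<close> in the exponent, a row in
      \<open>B\<close> the logarithm of the number of its possible sums; in total 0.07 + 4/160 +
      1/20 = 0.145.\<close>
    also have "\<dots> \<le> (\<Prod>j\<in>G. exp (4 * exp (- l))) * (\<Prod>j\<in>B. exp (ln (2 * real (row_size S U j) + 1)))"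
    proof (intro mult_mono prod_mono conjI prod_nonneg sum_nonneg)
      fix j assume "j \<in> G"
      have "(\<Sum>b\<in>Q j. exp (- l * \<bar>real_of_int b\<bar>)) \<le> 1 + 4 * exp (- l)"
        using finQ exp_l by (rule sum_exp_abs_le)
      also have "\<dots> \<le> exp (4 * exp (- l))" by (rule exp_ge_add_one_self)
      finally show "(\<Sum>b\<in>Q j. exp (- l * \<bar>real_of_int b\<bar>)) \<le> exp (4 * exp (- l))" .
    next
      fix j assume "j \<in> B"
      have "Q j \<subseteq> {- int (row_size S U j)..int (row_size S U j)}"
      proof
        fix b assume "b \<in> Q j"
        then obtain \<chi> where \<chi>: "\<chi> \<in> signings U" "b = \<lfloor>row_sum S U \<chi> j\<rfloor>"
          using \<open>j \<in> B\<close> by (auto simp: Q_def code_def G_def)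
        have "\<bar>\<chi> i\<bar> \<le> 1" if "i \<in> U" for i
          using PiE_mem[OF \<chi>(1) that] by auto
        then have "\<bar>row_sum S U \<chi> j\<bar> \<le> 1 * real (row_size S U j)"
          using U by (intro abs_row_sum_le)
        then have "row_sum S U \<chi> j \<le> real (row_size S U j)" "- real (row_size S U j) \<le> row_sum S U \<chi> j"
          by linarith+
        then show "b \<in> {- int (row_size S U j)..int (row_size S U j)}"
          unfolding \<chi>(2) by (auto simp: le_floor_iff) linarith
      qed
      then have "card (Q j) \<le> 2 * row_size S U j + 1"
        using card_mono[of "{- int (row_size S U j)..int (row_size S U j)}" "Q j"] by simp
      then show "real (card (Q j)) \<le> exp (ln (2 * real (row_size S U j) + 1))" by simp
    qed auto
    also have "(\<Prod>j\<in>G. exp (4 * exp (- l))) * (\<Prod>j\<in>B. exp (ln (2 * real (row_size S U j) + 1))) =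
      exp (4 * (real (card G) * exp (- l)) + (\<Sum>j\<in>B. ln (2 * real (row_size S U j) + 1)))"
      unfolding exp_add exp_sum[OF fin(2)] by (simp add: exp_of_nat_mult[symmetric] algebra_simps)
    also have "\<dots> \<le> exp (4 * (u / 160) + u / 20)"
      using G_few bad unfolding u_def exp_le_cancel_iff by linarith
    finally have "real (card C) \<le> exp (0.07 * u) * exp (4 * (u / 160) + u / 20)" by simp
    also have "\<dots> = exp (0.145 * u)" by (simp add: exp_add[symmetric])
    finally show ?thesis .
  qed

  have "\<exists>\<chi>\<in>T. \<exists>\<psi>\<in>T. restrict (code \<psi>) R = restrict (code \<chi>) R \<and> real (card {i\<in>U. \<psi> i \<noteq> \<chi> i}) > u / 10"
  proof (rule ccontr)
    assume contra: "\<not> ?thesis"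
    have finT: "finite T" using fin by (simp add: T_def)
    have "real (card {\<psi>\<in>T. restrict (code \<psi>) R = c}) \<le> exp (0.35 * u)" if c: "c \<in> C" for c
    proof -
      obtain \<chi> where \<chi>: "\<chi> \<in> T" "c = restrict (code \<chi>) R" using c unfolding C_def by blast
      have "{\<psi>\<in>T. restrict (code \<psi>) R = c} \<subseteq> {\<psi>\<in>signings U. real (card {i\<in>U. \<psi> i \<noteq> \<chi> i}) \<le> real (card U) / 10}"
        using contra \<chi> by (auto simp: T_def u_def not_less)
      then have "real (card {\<psi>\<in>T. restrict (code \<psi>) R = c}) \<le> real (card {\<psi>\<in>signings U. real (card {i\<in>U. \<psi> i \<noteq> \<chi> i}) \<le> real (card U) / 10})"
        using fin by (intro of_nat_mono card_mono) auto
      also have "\<dots> \<le> exp (0.35 * u)"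
        unfolding u_def using U \<chi> by (intro card_hamming_ball_le) (auto simp: T_def)
      finally show ?thesis .
    qed
    then have "(\<Sum>c\<in>C. real (card {\<psi>\<in>T. restrict (code \<psi>) R = c})) \<le> real (card C) * exp (0.35 * u)"
      using sum_bounded_above[of C "\<lambda>c. real (card {\<psi>\<in>T. restrict (code \<psi>) R = c})"] by simp
    moreover have "card T = (\<Sum>c\<in>C. card {\<psi>\<in>T. restrict (code \<psi>) R = c})"
    proof -
      have "card T = card (\<Union>c\<in>C. {\<psi>\<in>T. restrict (code \<psi>) R = c})"
        by (rule arg_cong[of _ _ card]) (auto simp: C_def)
      also have "\<dots> = (\<Sum>c\<in>C. card {\<psi>\<in>T. restrict (code \<psi>) R = c})"
        using finT by (intro card_UN_disjoint) (auto simp: C_def)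
      finally show ?thesis .
    qed
    ultimately have "real (card T) \<le> real (card C) * exp (0.35 * u)" by simp
    also have "\<dots> \<le> exp (0.145 * u) * exp (0.35 * u)" using card_C by (intro mult_right_mono) auto
    also have "\<dots> = exp (0.495 * u)" by (simp add: exp_add[symmetric])
    finally have "2 ^ card U / 2 \<le> exp (0.495 * u)" using card_T by simp
    moreover have "(2::real) ^ card U = exp (ln 2 * u)"
      by (simp add: u_def exp_of_nat2_mult)
    ultimately have "exp (ln 2 * u) \<le> 2 * exp (0.495 * u)" by simp
    also have "\<dots> \<le> exp 1 * exp (0.495 * u)"
      using exp_ge_add_one_self[of 1] by (intro mult_right_mono) auto
    also have "\<dots> = exp (1 + 0.495 * u)" by (simp add: exp_add)
    finally have "ln 2 * u \<le> 1 + 0.495 * u" by simp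
    \<comment> \<open>For \<open>u \<ge> 10\<close> the gap (2/3 - 0.495) u exceeds the 1 that
      stands for the factor 2.\<close>
    moreover have "2 / 3 * u \<le> ln 2 * u" using u ln2_ge_two_thirds by (intro mult_right_mono) auto
    ultimately show False using u by simp
  qed
  then obtain \<chi> \<psi> where *: "\<chi> \<in> T" "\<psi> \<in> T" "restrict (code \<psi>) R = restrict (code \<chi>) R"
    "real (card {i\<in>U. \<psi> i \<noteq> \<chi> i}) > u / 10" by blast
  have code_eq: "code \<psi> j = code \<chi> j" if "j \<in> R" for j
    using fun_cong[OF *(3), of j] that by simp
  \<comment> \<open>Equal buckets put the two row sums within \<open>2 * \<Delta>\<close> of each
    other; halving leaves \<open>\<Delta>\<close>.\<close>
  define y where "y i = (\<psi> i - \<chi> i) / 2" for i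
  have signs: "\<chi> i = -1 \<or> \<chi> i = 1" "\<psi> i = -1 \<or> \<psi> i = 1" if "i \<in> U" for i
    using *(1,2) that by (auto simp: T_def)
  have y: "row_sum S U y j = (row_sum S U \<psi> j - row_sum S U \<chi> j) / 2" for j
    unfolding row_sum_def y_def sum_subtractf[symmetric] sum_divide_distrib
    by (rule sum.cong) (auto simp: algebra_simps)
  have "y i \<in> {-1, 0, 1}" if "i \<in> U" for i
    using signs[OF that] by (auto simp: y_def)
  moreover have "{i\<in>U. y i \<noteq> 0} = {i\<in>U. \<psi> i \<noteq> \<chi> i}" by (auto simp: y_def)
  moreover have "\<bar>row_sum S U y j\<bar> \<le> \<Delta>" if "j \<in> R - B" for j
  proof -
    have "round (row_sum S U \<psi> j / \<Delta> / 2) = round (row_sum S U \<chi> j / \<Delta> / 2)"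
      using code_eq[of j] that by (simp add: code_def G_def)
    then have "\<bar>row_sum S U \<psi> j / \<Delta> / 2 - row_sum S U \<chi> j / \<Delta> / 2\<bar> \<le> 1"
      using of_int_round_abs_le[of "row_sum S U \<psi> j / \<Delta> / 2"] of_int_round_abs_le[of "row_sum S U \<chi> j / \<Delta> / 2"]
      by linarith
    also have "row_sum S U \<psi> j / \<Delta> / 2 - row_sum S U \<chi> j / \<Delta> / 2 = row_sum S U y j / \<Delta>"
      by (simp add: y diff_divide_distrib)
    finally show ?thesis using \<Delta> by (simp add: field_simps)
  qed
  moreover have "row_sum S U y j = 0" if "j \<in> B" for j
  proof -
    \<comment> \<open>Integrality makes the floor in the code lossless, so equal codes mean equal
      row sums.\<close>
    have "row_sum S U \<phi> j \<in> \<int>" if \<phi>: "\<phi> \<in> signings U" for \<phi>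
    proof -
      have "\<phi> i \<in> \<int>" if "i \<in> U" for i using PiE_mem[OF \<phi> that] by auto
      then show ?thesis unfolding row_sum_def by (intro Ints_sum Ints_mult) (auto simp: of_bool_def)
    qed
    then have "row_sum S U \<psi> j \<in> \<int>" "row_sum S U \<chi> j \<in> \<int>" using *(1,2) by (auto simp: T_def)
    moreover have "\<lfloor>row_sum S U \<psi> j\<rfloor> = \<lfloor>row_sum S U \<chi> j\<rfloor>"
      using code_eq[of j] that R by (auto simp: code_def G_def)
    ultimately have "row_sum S U \<psi> j = row_sum S U \<chi> j"
      by (metis of_int_floor)
    then show ?thesis by (simp add: y)
  qed
  ultimately show ?thesis using *(4) by (intro exI[of _ y]) (auto simp: u_def \<Delta>_def)
qed

section \<open>Concentration of submatrix sums\<close>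

lemma sum_power_card_Pow:
  fixes z :: "'b :: comm_semiring_1"
  assumes "finite X"
  shows "(\<Sum>B\<in>Pow X. z ^ card B) = (1 + z) ^ card X"
  using assms
proof (induction X rule: finite_induct)
  case (insert x X)
  have "(\<Sum>B\<in>Pow (insert x X). z ^ card B) = (\<Sum>B\<in>Pow X. z ^ card B) + (\<Sum>B\<in>insert x ` Pow X. z ^ card B)"
    unfolding Pow_insert using insert.hyps by (intro sum.union_disjoint) auto
  also have "(\<Sum>B\<in>insert x ` Pow X. z ^ card B) = (\<Sum>B\<in>Pow X. z ^ card (insert x B))"
    using insert.hyps by (subst sum.reindex) (auto simp: inj_on_def)
  also have "\<dots> = (\<Sum>B\<in>Pow X. z * z ^ card B)"
    using insert.hyps by (intro sum.cong) (auto simp: card_insert_if finite_subset)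
  finally show ?case using insert by (simp add: sum_distrib_left[symmetric] algebra_simps)
qed simp

text \<open>Multiplied-out bound for the probability that a random t-set contains b given points:
  after b points the next one contributes (t-b)/(m-b) \<le> t/m.\<close>

lemma binomial_diff_le:
  assumes "b \<le> t" "t \<le> m"
  shows "m ^ b * ((m - b) choose (t - b)) \<le> t ^ b * (m choose t)"
  using assms(1)
proof (induction b)
  case (Suc b)
  have *: "(t - b) * ((m - b) choose (t - b)) = (m - b) * ((m - Suc b) choose (t - Suc b))"
    using binomial_absorption[of "t - Suc b" "m - b"] Suc.prems
    by (simp add: Suc_diff_Suc)
  have "m * (t - b) \<le> t * (m - b)"
    using mult_le_mono2[OF assms(2), of b] by (simp add: diff_mult_distrib2 mult.commute diff_le_mono2)
  moreover have "m ^ b * ((m - b) choose (t - b)) \<le> t ^ b * (m choose t)"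
    using Suc.IH Suc.prems by simp
  ultimately have "m ^ b * ((m - b) choose (t - b)) * (m * (t - b)) \<le> (t ^ b * (m choose t)) * (t * (m - b))"
    by (rule mult_le_mono[rotated])
  also have "m ^ b * ((m - b) choose (t - b)) * (m * (t - b)) = m ^ Suc b * ((t - b) * ((m - b) choose (t - b)))"
    by (simp only: power_Suc ac_simps)
  also have "\<dots> = (m ^ Suc b * ((m - Suc b) choose (t - Suc b))) * (m - b)"
    unfolding * by (simp only: ac_simps)
  also have "(t ^ b * (m choose t)) * (t * (m - b)) = (t ^ Suc b * (m choose t)) * (m - b)"
    by (simp only: power_Suc ac_simps)
  finally have "(m ^ Suc b * ((m - Suc b) choose (t - Suc b))) * (m - b) \<le> (t ^ Suc b * (m choose t)) * (m - b)" .
  then show ?case using Suc.prems assms(2) by simp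
qed simp

text \<open>The entries of a column are dependent, but a given set \<open>B\<close> of ones is no
  more likely than for independent entries of density t/m.\<close>

lemma card_supersets_le:
  assumes "B \<subseteq> {..<m}" "t \<le> m"
  shows "m ^ card B * card {T. T \<subseteq> {..<m} \<and> card T = t \<and> B \<subseteq> T} \<le> t ^ card B * (m choose t)"
proof (cases "card B \<le> t")
  case True
  have fin: "finite B" using assms finite_subset by blast
  have "{T. T \<subseteq> {..<m} \<and> card T = t \<and> B \<subseteq> T} \<subseteq> (\<union>) B ` {T. T \<subseteq> {..<m} - B \<and> card T = t - card B}"
  proof
    fix T assume T: "T \<in> {T. T \<subseteq> {..<m} \<and> card T = t \<and> B \<subseteq> T}"
    then have "T = B \<union> (T - B)" "card (T - B) = t - card B"
      using fin by (auto simp: card_Diff_subset)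
    then show "T \<in> (\<union>) B ` {T. T \<subseteq> {..<m} - B \<and> card T = t - card B}"
      using T by blast
  qed
  then have "card {T. T \<subseteq> {..<m} \<and> card T = t \<and> B \<subseteq> T} \<le> card {T. T \<subseteq> {..<m} - B \<and> card T = t - card B}"
    by (intro surj_card_le) (auto intro: finite_subset[of _ "Pow {..<m}"])
  also have "\<dots> = (m - card B) choose (t - card B)"
    using assms fin by (subst n_subsets) (auto simp: card_Diff_subset)
  finally show ?thesis
    using binomial_diff_le[OF True assms(2)] by (meson mult_le_mono2 order.trans)
next
  case False
  have "{T. T \<subseteq> {..<m} \<and> card T = t \<and> B \<subseteq> T} = {}"
    using False card_mono[of _ B] finite_subset[of _ "{..<m}"] by fastforce
  then show ?thesis by (simp only: card.empty mult_0_right le0)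
qed

text \<open>Expanding \<open>x ^ card (T \<inter> R)\<close> over the subsets of
  \<open>T \<inter> R\<close> gives powers of \<open>x - 1\<close>, nonnegative by
  \<open>x \<ge> 1\<close>. So the bounds on inclusion probabilities apply termwise and resum to the
  binomial moment generating function.\<close>

lemma sum_power_card_Int_le:
  fixes x :: real
  assumes R: "R \<subseteq> {..<m}" and t: "t \<le> m" "m > 0" and x: "x \<ge> 1"
  shows "(\<Sum>T | T \<subseteq> {..<m} \<and> card T = t. x ^ card (T \<inter> R)) \<le>
    real (m choose t) * exp ((x - 1) * real t * real (card R) / real m)"
proof -
  define F where "F = {T. T \<subseteq> {..<m} \<and> card T = t}"
  have finF: "finite F" by (rule finite_subset[of _ "Pow {..<m}"]) (auto simp: F_def)
  have finR: "finite R" using R finite_subset by blast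
  have "(\<Sum>T\<in>F. x ^ card (T \<inter> R)) = (\<Sum>T\<in>F. \<Sum>B\<in>Pow (T \<inter> R). (x - 1) ^ card B)"
    by (rule sum.cong[OF refl], subst sum_power_card_Pow) (use finR in auto)
  also have "\<dots> = (\<Sum>T\<in>F. \<Sum>B\<in>{B\<in>Pow R. B \<subseteq> T}. (x - 1) ^ card B)"
    by (intro sum.cong) auto
  also have "\<dots> = (\<Sum>B\<in>Pow R. \<Sum>T\<in>{T\<in>F. B \<subseteq> T}. (x - 1) ^ card B)"
    using finF finR by (intro sum.swap_restrict) auto
  also have "\<dots> = (\<Sum>B\<in>Pow R. real (card {T. T \<subseteq> {..<m} \<and> card T = t \<and> B \<subseteq> T}) * (x - 1) ^ card B)"
    by (simp add: F_def conj_assoc)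
  also have "\<dots> \<le> (\<Sum>B\<in>Pow R. real (m choose t) * ((x - 1) * real t / real m) ^ card B)"
  proof (rule sum_mono)
    fix B assume "B \<in> Pow R"
    then have "m ^ card B * card {T. T \<subseteq> {..<m} \<and> card T = t \<and> B \<subseteq> T} \<le> t ^ card B * (m choose t)"
      using R t by (intro card_supersets_le) auto
    then have "real m ^ card B * real (card {T. T \<subseteq> {..<m} \<and> card T = t \<and> B \<subseteq> T}) \<le> real t ^ card B * real (m choose t)"
      unfolding of_nat_mult[symmetric] of_nat_power[symmetric] by (rule of_nat_mono)
    then have "real (card {T. T \<subseteq> {..<m} \<and> card T = t \<and> B \<subseteq> T}) \<le> real (m choose t) * (real t / real m) ^ card B"
      using t by (simp add: field_simps power_divide)
    then have "real (card {T. T \<subseteq> {..<m} \<and> card T = t \<and> B \<subseteq> T}) * (x - 1) ^ card B \<le>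
      real (m choose t) * (real t / real m) ^ card B * (x - 1) ^ card B"
      using x by (intro mult_right_mono) auto
    also have "\<dots> = real (m choose t) * ((x - 1) * real t / real m) ^ card B"
      by (simp add: power_mult_distrib power_divide)
    finally show "real (card {T. T \<subseteq> {..<m} \<and> card T = t \<and> B \<subseteq> T}) * (x - 1) ^ card B \<le>
      real (m choose t) * ((x - 1) * real t / real m) ^ card B" .
  qed
  also have "\<dots> = real (m choose t) * (1 + (x - 1) * real t / real m) ^ card R"
    unfolding sum_distrib_left[symmetric] sum_power_card_Pow[OF finR] ..
  also have "\<dots> \<le> real (m choose t) * exp ((x - 1) * real t / real m) ^ card R"
    using x by (intro mult_left_mono power_mono exp_ge_add_one_self) (auto intro!: add_nonneg_nonneg divide_nonneg_nonneg)
  also have "exp ((x - 1) * real t / real m) ^ card R = exp ((x - 1) * real t * real (card R) / real m)"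
    by (simp add: exp_of_nat_mult[symmetric] mult.commute)
  finally show ?thesis unfolding F_def .
qed

section \<open>Random columns and the Chernoff bound\<close>

definition supp :: "real vec \<Rightarrow> nat set" where
  "supp v = {j. j < dim_vec v \<and> v $ j = 1}"

lemma bij_betw_supp: "bij_betw supp (binary_vecs m t) {T. T \<subseteq> {..<m} \<and> card T = t}"
proof (rule bij_betw_byWitness[of _ "\<lambda>T. vec m (\<lambda>j. of_bool (j \<in> T))"])
  show "\<forall>v\<in>binary_vecs m t. vec m (\<lambda>j. of_bool (j \<in> supp v)) = v"
    by (auto simp: binary_vecs_def supp_def intro!: eq_vecI)
  show "\<forall>T\<in>{T. T \<subseteq> {..<m} \<and> card T = t}. supp (vec m (\<lambda>j. of_bool (j \<in> T))) = T"
    by (auto simp: supp_def)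
  show "supp ` binary_vecs m t \<subseteq> {T. T \<subseteq> {..<m} \<and> card T = t}"
    by (auto simp: binary_vecs_def supp_def)
  show "(\<lambda>T. vec m (\<lambda>j. of_bool (j \<in> T))) ` {T. T \<subseteq> {..<m} \<and> card T = t} \<subseteq> binary_vecs m t"
  proof safe
    fix T assume T: "T \<subseteq> {..<m}" "t = card T"
    then have "{i. i < m \<and> vec m (\<lambda>j. of_bool (j \<in> T)) $ i = (1::real)} = T"
      by auto
    then show "vec m (\<lambda>j. of_bool (j \<in> T)) \<in> binary_vecs m (card T)"
      by (auto simp: binary_vecs_def of_bool_def)
  qed
qed

lemma expectation_power_card_supp_Int_le:
  fixes x :: real
  assumes R: "R \<subseteq> {..<m}" and t: "t \<le> m" "m > 0" and x: "x \<ge> 1"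
  shows "measure_pmf.expectation (pmf_of_set (binary_vecs m t)) (\<lambda>v. x ^ card (supp v \<inter> R)) \<le>
    exp ((x - 1) * real t * real (card R) / real m)"
proof -
  have "card (binary_vecs m t) = m choose t"
    using bij_betw_same_card[OF bij_betw_supp[of m t]] n_subsets[of "{..<m}" t] by simp
  moreover have "(\<Sum>v\<in>binary_vecs m t. x ^ card (supp v \<inter> R)) = (\<Sum>T | T \<subseteq> {..<m} \<and> card T = t. x ^ card (T \<inter> R))"
    by (rule sum.reindex_bij_betw[OF bij_betw_supp])
  moreover have "m choose t > 0" using t by simp
  ultimately show ?thesis
    using sum_power_card_Int_le[OF assms] binary_vecs_nonempty[OF t(1)] finite_binary_vecs[of m t]
    by (simp add: integral_pmf_of_set field_simps)
qed

abbreviation random_columns :: "nat \<Rightarrow> nat \<Rightarrow> nat \<Rightarrow> (nat \<Rightarrow> real vec) pmf" where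
  "random_columns m k t \<equiv> Pi_pmf {..<k} (0\<^sub>v m) (\<lambda>_. pmf_of_set (binary_vecs m t))"

lemma finite_set_random_columns:
  assumes "t \<le> m"
  shows "finite (set_pmf (random_columns m k t))"
proof -
  have "set_pmf (pmf_of_set (binary_vecs m t)) = binary_vecs m t"
    by (rule set_pmf_of_set[OF binary_vecs_nonempty[OF assms] finite_binary_vecs])
  then show ?thesis by (auto simp: set_Pi_pmf intro!: finite_PiE_dflt finite_binary_vecs)
qed

text \<open>Markov's inequality for x to the power of the number of ones, with the optimal base
  \<open>x = a / mu\<close>; independence is used only between columns.\<close>

lemma prob_many_ones_le:
  assumes V: "V \<subseteq> {..<k}" and R: "R \<subseteq> {..<m}" and t: "t \<le> m" "m > 0"
    and mu: "mu = real (card V) * real (card R) * real t / real m" "mu > 0" "mu \<le> a"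
  shows "measure_pmf.prob (random_columns m k t) {c. a \<le> real (\<Sum>j\<in>R. row_size (supp \<circ> c) V j)}
    \<le> exp (- a * (ln (a / mu) - 1))"
proof -
  define x where "x = a / mu"
  have x: "x \<ge> 1" using mu(2,3) by (simp add: x_def)
  let ?P = "random_columns m k t"
  have finV: "finite V" and finR: "finite R" using V R finite_subset by blast+
  \<comment> \<open>Base 1 outside \<open>V\<close> extends the product to all \<open>k\<close>
    columns, the form in which the expectation factorises.\<close>
  define f where "f c = (\<Prod>i<k. (if i \<in> V then x else 1) ^ card (supp (c i) \<inter> R))" for c
  have f: "f c = exp (ln x * real (\<Sum>j\<in>R. row_size (supp \<circ> c) V j))" for c
  proof -
    have "f c = (\<Prod>i\<in>V. x ^ card (supp (c i) \<inter> R))"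
      unfolding f_def using V by (intro prod.mono_neutral_cong_right) auto
    also have "\<dots> = x ^ (\<Sum>j\<in>R. row_size (supp \<circ> c) V j)"
      unfolding sum_row_size[OF finV finR] by (simp add: power_sum)
    finally show ?thesis using x by (simp add: mult.commute[of "ln x"] exp_of_nat_mult del: of_nat_sum)
  qed
  have int: "integrable (measure_pmf ?P) g" for g :: "_ \<Rightarrow> real"
    using finite_set_random_columns[OF t(1)] by (intro integrable_measure_pmf_finite)
  have "measure_pmf.prob ?P {c. a \<le> real (\<Sum>j\<in>R. row_size (supp \<circ> c) V j)} =
    measure_pmf.expectation ?P (indicat_real {c. a \<le> real (\<Sum>j\<in>R. row_size (supp \<circ> c) V j)})"
    by simp
  also have "\<dots> \<le> measure_pmf.expectation ?P (\<lambda>c. exp (- a * ln x) * f c)"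
  proof (rule integral_mono[OF int int])
    fix c
    show "indicat_real {c. a \<le> real (\<Sum>j\<in>R. row_size (supp \<circ> c) V j)} c \<le> exp (- a * ln x) * f c"
      using x unfolding f exp_add[symmetric]
      by (auto simp: indicator_def mult.commute[of _ "ln x"] intro!: mult_left_mono)
  qed
  also have "\<dots> = exp (- a * ln x) * measure_pmf.expectation ?P f" by simp
  also have "measure_pmf.expectation ?P f =
    (\<Prod>i<k. measure_pmf.expectation (pmf_of_set (binary_vecs m t)) (\<lambda>v. (if i \<in> V then x else 1) ^ card (supp v \<inter> R)))"
    unfolding f_def using x set_pmf_of_set[OF binary_vecs_nonempty[OF t(1)] finite_binary_vecs]
    by (intro expectation_prod_Pi_pmf integrable_measure_pmf_finite) (auto simp: finite_binary_vecs)
  also have "\<dots> = (\<Prod>i\<in>V. measure_pmf.expectation (pmf_of_set (binary_vecs m t)) (\<lambda>v. x ^ card (supp v \<inter> R)))"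
    using V by (intro prod.mono_neutral_cong_right) auto
  also have "\<dots> \<le> (\<Prod>i\<in>V. exp ((x - 1) * real t * real (card R) / real m))"
    using expectation_power_card_supp_Int_le[OF R t x] x by (intro prod_mono) auto
  also have "\<dots> = exp ((x - 1) * mu)" by (simp add: exp_of_nat_mult[symmetric] mu algebra_simps)
  also have "\<dots> \<le> exp a" using mu(2,3) by (simp add: x_def field_simps)
  also have "exp (- a * ln x) * exp a = exp (- a * (ln (a / mu) - 1))"
    by (simp add: exp_add[symmetric] x_def algebra_simps)
  finally show ?thesis by (simp add: comp_def del: of_nat_sum)
qed

text \<open>The bound (e n / r)^r, from a single term of the binomial expansion of (1 + r/n)^n \<le>
  e^r.\<close>

lemma binomial_le_exp:
  assumes "r > 0" "r \<le> n"
  shows "real (n choose r) \<le> exp (real r * (1 + ln (real n / real r)))"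
proof -
  define p where "p = real r / real n"
  have p: "p > 0" using assms by (simp add: p_def)
  have "real (n choose r) * p ^ r \<le> (\<Sum>i\<le>n. real (n choose i) * p ^ i * 1 ^ (n - i))"
    using member_le_sum[of r "{..n}" "\<lambda>i. real (n choose i) * p ^ i * 1 ^ (n - i)"] assms p by simp
  also have "\<dots> = (p + 1) ^ n" by (rule binomial_ring[symmetric])
  also have "\<dots> \<le> exp p ^ n" using exp_ge_add_one_self[of p] p by (intro power_mono) (simp_all add: add.commute)
  also have "\<dots> = exp (real r)" using assms by (simp add: p_def exp_of_nat_mult[symmetric])
  finally have "real (n choose r) \<le> exp (real r) / p ^ r" using p by (simp add: field_simps)
  also have "p ^ r = exp (real r * ln p)" using p by (simp add: exp_of_nat_mult)
  also have "exp (real r) / exp (real r * ln p) = exp (real r * (1 + ln (real n / real r)))"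
    using assms by (simp add: exp_diff[symmetric] p_def ln_div algebra_simps)
  finally show ?thesis .
qed

text \<open>The \<open>r\<close> heavy rows together contain at least \<open>r * s\<close> ones
  against a mean of r u t / m, so the Chernoff ratio does not depend on \<open>r\<close>. The first
  two summands of the exponent count the choices of \<open>V\<close> and \<open>R\<close>.\<close>

lemma prob_heavy_submatrix_le:
  fixes s :: real
  assumes t: "t \<le> m" "t > 0" and u: "u > 0" and r: "r > 0" "r \<le> m"
    and s: "real u * real t / real m \<le> s"
  shows "measure_pmf.prob (random_columns m k t)
     {c. \<exists>V R. V \<subseteq> {..<k} \<and> card V = u \<and> R \<subseteq> {..<m} \<and> card R = r \<and> (\<forall>j\<in>R. s < real (row_size (supp \<circ> c) V j))}
    \<le> exp (real u * (1 + ln (real k / real u)) + real r * (1 + ln (real m / real r))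
         - real r * s * (ln (s * real m / (real u * real t)) - 1))"
proof (cases "u \<le> k")
  case False
  have "\<not> (V \<subseteq> {..<k} \<and> card V = u)" for V
    using False card_mono[of "{..<k}" V] by auto
  then have "{c. \<exists>V R. V \<subseteq> {..<k} \<and> card V = u \<and> R \<subseteq> {..<m} \<and> card R = r \<and>
    (\<forall>j\<in>R. s < real (row_size (supp \<circ> c) V j))} = {}" by blast
  then show ?thesis by (simp only: measure_empty exp_ge_zero)
next
  case True
  let ?P = "random_columns m k t"
  define I where "I = {V. V \<subseteq> {..<k} \<and> card V = u} \<times> {R. R \<subseteq> {..<m} \<and> card R = r}"
  define E where "E = (\<lambda>(V, R). {c :: nat \<Rightarrow> real vec. real r * s \<le> real (\<Sum>j\<in>R. row_size (supp \<circ> c) V j)})"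
  define e where "e = exp (- (real r * s * (ln (s * real m / (real u * real t)) - 1)))"
  have m: "m > 0" using t by simp
  have "finite {V. V \<subseteq> {..<n} \<and> card V = l}" for n l :: nat
    by (rule finite_subset[of _ "Pow {..<n}"]) auto
  then have finI: "finite I" unfolding I_def by (intro finite_cartesian_product)
  have "{c. \<exists>V R. V \<subseteq> {..<k} \<and> card V = u \<and> R \<subseteq> {..<m} \<and> card R = r \<and> (\<forall>j\<in>R. s < real (row_size (supp \<circ> c) V j))} \<subseteq> (\<Union>p\<in>I. E p)"
  proof safe
    fix c V R assume *: "V \<subseteq> {..<k}" "u = card V" "R \<subseteq> {..<m}" "r = card R" "\<forall>j\<in>R. s < real (row_size (supp \<circ> c) V j)"
    have "(\<Sum>j\<in>R. s) \<le> (\<Sum>j\<in>R. real (row_size (supp \<circ> c) V j))"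
      using *(5) by (intro sum_mono) (auto intro: less_imp_le)
    then have "c \<in> E (V, R)" using *(4) by (simp add: E_def)
    moreover have "(V, R) \<in> I" using * by (simp add: I_def)
    ultimately show "c \<in> (\<Union>p\<in>I. E p)" by blast
  qed
  then have "measure_pmf.prob ?P {c. \<exists>V R. V \<subseteq> {..<k} \<and> card V = u \<and> R \<subseteq> {..<m} \<and> card R = r \<and> (\<forall>j\<in>R. s < real (row_size (supp \<circ> c) V j))} \<le>
    measure_pmf.prob ?P (\<Union>p\<in>I. E p)"
    by (intro measure_pmf.finite_measure_mono) auto
  also have "\<dots> \<le> (\<Sum>p\<in>I. measure_pmf.prob ?P (E p))"
    using finI by (intro measure_pmf.finite_measure_subadditive_finite) auto
  also have "\<dots> \<le> (\<Sum>p\<in>I. e)"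
  proof (rule sum_mono, safe)
    fix V R assume "(V, R) \<in> I"
    then have *: "V \<subseteq> {..<k}" "card V = u" "R \<subseteq> {..<m}" "card R = r" by (auto simp: I_def)
    define mu where "mu = real (card V) * real (card R) * real t / real m"
    have "mu > 0" using * u r t m by (simp add: mu_def)
    moreover have "mu = real r * (real u * real t / real m)" using * by (simp add: mu_def)
    then have "mu \<le> real r * s" using s by (simp only:) (intro mult_left_mono, auto)
    ultimately have "measure_pmf.prob ?P (E (V, R)) \<le> exp (- (real r * s) * (ln (real r * s / mu) - 1))"
      unfolding E_def prod.case using * t m by (intro prob_many_ones_le[where mu = mu]) (auto simp: mu_def)
    also have "real r * s / mu = s * real m / (real u * real t)"
      using * u r t m by (simp add: mu_def field_simps)
    finally show "measure_pmf.prob ?P (E (V, R)) \<le> e" by (simp add: e_def)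
  qed
  also have "\<dots> = real (k choose u) * real (m choose r) * e"
    using n_subsets[of "{..<k}" u] n_subsets[of "{..<m}" r] by (simp add: I_def card_cartesian_product)
  also have "\<dots> \<le> exp (real u * (1 + ln (real k / real u))) * exp (real r * (1 + ln (real m / real r))) * e"
    using True u r by (intro mult_mono binomial_le_exp) (auto simp: e_def)
  also have "\<dots> = exp (real u * (1 + ln (real k / real u)) + real r * (1 + ln (real m / real r))
         - real r * s * (ln (s * real m / (real u * real t)) - 1))"
    by (simp only: e_def exp_add[symmetric] add_uminus_conv_diff)
  finally show ?thesis .
qed

section \<open>The two exponents of the union bound\<close>

text \<open>The origin of the 8 in the thresholds: it exceeds e^2, so the Chernoff factor
  \<open>ln (s * m / (u * t)) - 1\<close> is at least 1.\<close>

lemma ln_8_ge: "ln (8 :: real) \<ge> 2"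
proof -
  have "exp (2 :: real) = exp 1 ^ 2" by (simp add: exp_of_nat_mult[symmetric])
  also have "\<dots> \<le> 2.72 ^ 2" using e_less_272 by (intro power_mono) auto
  also have "\<dots> \<le> (8 :: real)" by (simp add: power2_eq_square)
  finally show ?thesis by (simp add: ln_ge_iff)
qed

text \<open>With q = t^(1/4), the density u/m \<ge> 1/q^2 gives s \<ge> 8 q^3. Half of r s, at least
  4 r q^3, pays for the rows, whose choice costs at most r q^3. The other half is at least 4 u q^2
  by r \<ge> u/q and covers 2 u q^2 for the columns and t \<le> u q^2. The \<open>- u\<close> is
  kept for summing over the sizes.\<close>

lemma dense_exponent_le:
  fixes t m k u r s :: real
  assumes t: "t \<ge> 1" "t \<le> m" and u: "u > 0" "u \<le> m" "m \<le> u * sqrt t" and k: "k > 0"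
    and L: "ln (exp 1 * k / m) \<le> sqrt t" and r: "r \<ge> u / sqrt (sqrt t)"
    and s: "s = 8 * t * sqrt (u / m)"
  shows "u * (1 + ln (k / u)) + r * (1 + ln (m / r)) - r * s * (ln (s * m / (u * t)) - 1) \<le> - t - u"
proof -
  define q where "q = sqrt (sqrt t)"
  define w where "w = sqrt (u / m)"
  have m: "m > 0" using t by linarith
  have q: "q \<ge> 1" "q\<^sup>2 = sqrt t" using t by (auto simp: q_def)
  then have q4: "t = q\<^sup>2 * q\<^sup>2" using t by simp
  have w: "w > 0" "w \<le> 1" "w\<^sup>2 = u / m" using u m by (auto simp: w_def)
  have r0: "r > 0" using r u q by (simp add: q_def[symmetric]) (smt (verit) divide_pos_pos)
  have wq: "w * q \<ge> 1"
  proof -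
    have "1 \<le> (w * q)\<^sup>2" using u m by (simp add: power_mult_distrib w q field_simps)
    then show ?thesis using w q by (smt (verit) mult_nonneg_nonneg power2_le_imp_le one_power2)
  qed
  have um: "u = w * w * m" using w m by (simp add: power2_eq_square)
  have "s * m / (u * t) = 8 * w * m / u" using t by (simp add: s w_def[symmetric])
  also have "\<dots> = 8 / w" unfolding um using w(1) m by simp
  also have "ln \<dots> = ln 8 - ln w" using w by (simp add: ln_div)
  also have "\<dots> \<ge> 2" using ln_8_ge w ln_le_zero_iff[of w] by linarith
  finally have ln1: "ln (s * m / (u * t)) - 1 \<ge> 1" by linarith
  have "s = 8 * q ^ 3 * (w * q)"
    unfolding s w_def[symmetric] q4 by (simp add: power2_eq_square power3_eq_cube)
  then have s_ge: "s \<ge> 8 * q ^ 3" using mult_left_mono[OF wq, of "8 * q ^ 3"] q by simp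
  have s0: "s \<ge> 0" using s_ge q by (smt (verit) zero_le_power)
  have "r * s * 1 \<le> r * s * (ln (s * m / (u * t)) - 1)"
    using ln1 r0 s0 by (intro mult_left_mono) auto
  moreover have "r * (8 * q ^ 3) \<le> r * s" using s_ge r0 by (intro mult_left_mono) auto
  moreover have "u * q\<^sup>2 \<le> r * q ^ 3"
  proof -
    have "u \<le> r * q" using r q by (simp add: q_def[symmetric] field_simps)
    then have "u * q\<^sup>2 \<le> r * q * q\<^sup>2" by (intro mult_right_mono) auto
    then show ?thesis by (simp add: power2_eq_square power3_eq_cube mult.assoc)
  qed
  ultimately have main: "r * s * (ln (s * m / (u * t)) - 1) \<ge> 4 * (r * q ^ 3) + 4 * (u * q\<^sup>2)"
    by linarith
  \<comment> \<open>The number \<open>k\<close> of columns enters through \<open>L\<close>; what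
    remains is the density of \<open>u\<close> in \<open>m\<close>.\<close>
  have "1 + ln (k / u) = ln (exp 1 * k / m) + ln (m / u)"
    using k u m by (simp add: ln_div ln_mult)
  also have "ln (m / u) \<le> ln (q\<^sup>2)" using u m q t by (intro ln_mono) (auto simp: field_simps)
  also have "ln (q\<^sup>2) \<le> q\<^sup>2 - 1" using q t by (intro ln_le_minus_one) auto
  finally have "1 + ln (k / u) \<le> 2 * q\<^sup>2 - 1" using L q by linarith
  then have first: "u * (1 + ln (k / u)) \<le> u * (2 * q\<^sup>2 - 1)" using u by (intro mult_left_mono) auto
  have "m / r \<le> q ^ 3"
  proof -
    have "m \<le> u * q\<^sup>2" using u q by simp
    also have "\<dots> \<le> r * q ^ 3" by fact
    finally show ?thesis using r0 by (simp add: field_simps)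
  qed
  then have "ln (m / r) \<le> ln (q ^ 3)" using m r0 q by (intro ln_mono) auto
  also have "\<dots> \<le> q ^ 3 - 1" using q by (intro ln_le_minus_one) auto
  finally have "r * (1 + ln (m / r)) \<le> r * q ^ 3" using r0 by (intro mult_left_mono) auto
  moreover have "t \<le> u * q\<^sup>2" using t u q by simp
  moreover have "r * q ^ 3 \<ge> 0" "u * q\<^sup>2 \<ge> 0" using r0 q u by auto
  moreover have "u * (2 * q\<^sup>2 - 1) = 2 * (u * q\<^sup>2) - u" by (simp add: algebra_simps)
  ultimately show ?thesis using main first by linarith
qed

text \<open>Here r = u, and \<open>y\<close> is the ratio of sqrt t to the mean row size. The
  choices of \<open>V\<close> and \<open>R\<close> cost at most 3 u sqrt t - u + 2 u ln y, while the
  Chernoff term gains at least 8 u sqrt t + 8 u ln y. The lower bound on \<open>u\<close> gives t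
  \<le> u sqrt t.\<close>

lemma sparse_exponent_le:
  fixes t m k u s :: real
  assumes t: "t \<ge> 1" "t \<le> m" and u: "u > 0" "u * sqrt t < m" "8 * sqrt t \<le> u" and k: "k > 0"
    and L: "ln (exp 1 * k / m) \<le> sqrt t" and s: "s = 8 * sqrt t"
  shows "u * (1 + ln (k / u)) + u * (1 + ln (m / u)) - u * s * (ln (s * m / (u * t)) - 1) \<le> - t - u"
proof -
  define p where "p = sqrt t"
  define y where "y = m / (u * p)"
  have m: "m > 0" using t by linarith
  have p: "p \<ge> 1" "t = p * p" using t by (auto simp: p_def)
  have y: "y > 1" using u p by (simp add: y_def p_def[symmetric])
  have "s * m / (u * t) = 8 * y" using p u by (simp add: s p_def[symmetric] y_def)
  also have "ln \<dots> = ln 8 + ln y" using y by (simp add: ln_mult)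
  also have "\<dots> \<ge> 2 + ln y" using ln_8_ge by simp
  finally have "1 + ln y \<le> ln (s * m / (u * t)) - 1" by linarith
  then have "u * s * (1 + ln y) \<le> u * s * (ln (s * m / (u * t)) - 1)"
    using u p by (intro mult_left_mono) (auto simp: s p_def[symmetric])
  moreover have "u * s * (1 + ln y) = 8 * (u * p) + 8 * (p * (u * ln y))"
    by (simp add: s p_def algebra_simps)
  moreover have uy: "u * ln y \<ge> 0" using u y by simp
  then have "1 * (u * ln y) \<le> p * (u * ln y)" using p by (intro mult_right_mono) auto
  ultimately have main: "u * s * (ln (s * m / (u * t)) - 1) \<ge> 8 * (u * p) + 8 * (u * ln y)" by linarith
  have "m / u = y * p" using u p by (simp add: y_def)
  then have "ln (m / u) = ln y + ln p" using y p by (simp add: ln_mult)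
  also have "\<dots> \<le> ln y + (p - 1)" using p ln_le_minus_one[of p] by simp
  finally have mu: "ln (m / u) \<le> ln y + (p - 1)" .
  have "1 + ln (k / u) = ln (exp 1 * k / m) + ln (m / u)"
    using k u m by (simp add: ln_div ln_mult)
  then have "(1 + ln (k / u)) + (1 + ln (m / u)) \<le> 3 * p - 1 + 2 * ln y" using L mu unfolding p_def by linarith
  then have "u * ((1 + ln (k / u)) + (1 + ln (m / u))) \<le> u * (3 * p - 1 + 2 * ln y)"
    using u by (intro mult_left_mono) auto
  moreover have "u * (3 * p - 1 + 2 * ln y) = 3 * (u * p) - u + 2 * (u * ln y)"
    by (simp add: algebra_simps)
  moreover have "u * ((1 + ln (k / u)) + (1 + ln (m / u))) = u * (1 + ln (k / u)) + u * (1 + ln (m / u))"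
    by (simp add: algebra_simps)
  moreover have "t \<le> u * p"
  proof -
    have "p * p \<le> u * p" using u p by (intro mult_right_mono) (auto simp: p_def[symmetric])
    then show ?thesis using p by simp
  qed
  moreover have "u * p \<ge> 0" using u p by auto
  ultimately show ?thesis using main uy by linarith
qed

section \<open>Regularity with high probability\<close>

text \<open>The strict bound for sparse sets is the hypothesis \<open>few\<close> of
  \<open>beck_fiala\<close>; the bound for dense sets keeps the cost of the exactly balanced rows in
  \<open>partial_colouring\<close> below \<open>card V / 20\<close> for large
  \<open>t\<close>.\<close>

definition regular_on :: "nat \<Rightarrow> nat \<Rightarrow> (nat \<Rightarrow> nat set) \<Rightarrow> nat set \<Rightarrow> bool" where
  "regular_on m t S V \<longleftrightarrow>
     (if real m \<le> real (card V) * sqrt (real t)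
      then real (card {j. j < m \<and> 8 * real t * sqrt (real (card V) / real m) < real (row_size S V j)})
        \<le> real (card V) / sqrt (sqrt (real t))
      else card {j. j < m \<and> 8 * sqrt (real t) < real (row_size S V j)} < card V)"

lemma prob_irregular_le:
  assumes t: "t > 0" "t \<le> m" and k: "k > 0" and u: "u > 0" "u \<le> m"
    and L: "ln (exp 1 * real k / real m) \<le> sqrt (real t)"
  shows "measure_pmf.prob (random_columns m k t)
      {c. \<exists>V\<subseteq>{..<k}. card V = u \<and> \<not> regular_on m t (supp \<circ> c) V} \<le> exp (- real t - real u)"
    (is "measure_pmf.prob ?P ?E \<le> _")
proof -
  \<comment> \<open>Failure of regularity provides \<open>r\<close> heavy rows; it remains to choose
    \<open>r\<close> and \<open>s\<close> according to the density.\<close>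
  have heavy: "measure_pmf.prob ?P ?E \<le> exp X"
    if r: "r > 0" "r \<le> m" and s: "real u * real t / real m \<le> s"
      and E: "\<And>c V. card V = u \<Longrightarrow> \<not> regular_on m t (supp \<circ> c) V \<Longrightarrow>
        r \<le> card {j. j < m \<and> s < real (row_size (supp \<circ> c) V j)}"
      and X: "real u * (1 + ln (real k / real u)) + real r * (1 + ln (real m / real r))
         - real r * s * (ln (s * real m / (real u * real t)) - 1) \<le> X" for r s X
  proof -
    have "?E \<subseteq> {c. \<exists>V R. V \<subseteq> {..<k} \<and> card V = u \<and> R \<subseteq> {..<m} \<and> card R = r \<and>
      (\<forall>j\<in>R. s < real (row_size (supp \<circ> c) V j))}"
    proof safe
      fix c V assume *: "V \<subseteq> {..<k}" "u = card V" "\<not> regular_on m t (supp \<circ> c) V"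
      then have "r \<le> card {j. j < m \<and> s < real (row_size (supp \<circ> c) V j)}" using E by blast
      then obtain R where "R \<subseteq> {j. j < m \<and> s < real (row_size (supp \<circ> c) V j)}" "card R = r"
        by (rule obtain_subset_with_card_n)
      then show "\<exists>V' R. V' \<subseteq> {..<k} \<and> card V' = card V \<and> R \<subseteq> {..<m} \<and> card R = r \<and>
        (\<forall>j\<in>R. s < real (row_size (supp \<circ> c) V' j))"
        using * by (intro exI[of _ V] exI[of _ R]) auto
    qed
    then have "measure_pmf.prob ?P ?E \<le> measure_pmf.prob ?P {c. \<exists>V R. V \<subseteq> {..<k} \<and> card V = u \<and> R \<subseteq> {..<m} \<and> card R = r \<and>
      (\<forall>j\<in>R. s < real (row_size (supp \<circ> c) V j))}"
      by (intro measure_pmf.finite_measure_mono) auto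
    also have "\<dots> \<le> exp (real u * (1 + ln (real k / real u)) + real r * (1 + ln (real m / real r))
         - real r * s * (ln (s * real m / (real u * real t)) - 1))"
      using t u r s by (intro prob_heavy_submatrix_le) auto
    also have "\<dots> \<le> exp X" using X by simp
    finally show ?thesis .
  qed
  have m: "m > 0" using t by simp
  have st: "sqrt (real t) \<ge> 1" "sqrt (sqrt (real t)) \<ge> 1" using t by auto
  show ?thesis
  proof (cases "real m \<le> real u * sqrt (real t)")
    case True
    \<comment> \<open>An irregular dense set has more than u t^(-1/4) heavy rows, hence at least
      this rounded-up number.\<close>
    define r where "r = nat \<lceil>real u / sqrt (sqrt (real t))\<rceil>"
    define s where "s = 8 * real t * sqrt (real u / real m)"
    have pos: "real u / sqrt (sqrt (real t)) > 0" using u t by simp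
    have "real u / sqrt (sqrt (real t)) \<le> real u" using st u by (simp add: divide_le_eq)
    then have r: "r > 0" "r \<le> m" "real r \<ge> real u / sqrt (sqrt (real t))"
      using pos u by (auto simp: r_def)
    have "real u / real m \<le> 1" using u by simp
    then have "(real u / real m)\<^sup>2 \<le> real u / real m"
      unfolding power2_eq_square using mult_right_mono[of "real u / real m" 1 "real u / real m"] by simp
    then have "real u / real m \<le> sqrt (real u / real m)" by (rule real_le_rsqrt)
    then have "real t * (real u / real m) \<le> real t * sqrt (real u / real m)" by (intro mult_left_mono) auto
    moreover have "0 \<le> real t * sqrt (real u / real m)" by simp
    ultimately have "real t * (real u / real m) \<le> 8 * real t * sqrt (real u / real m)" by linarith
    then have s: "real u * real t / real m \<le> s" by (simp add: s_def mult.commute)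
    show ?thesis
    proof (rule heavy[OF r(1,2) s])
      fix c V assume "card V = u" "\<not> regular_on m t (supp \<circ> c) V"
      then have "real u / sqrt (sqrt (real t)) < real (card {j. j < m \<and> s < real (row_size (supp \<circ> c) V j)})"
        using True by (simp add: regular_on_def s_def)
      then show "r \<le> card {j. j < m \<and> s < real (row_size (supp \<circ> c) V j)}"
        unfolding r_def by linarith
    qed (use t u k L r True in \<open>intro dense_exponent_le; simp add: s_def\<close>)
  next
    case False
    show ?thesis
    proof (cases "8 * sqrt (real t) \<le> real u")
      case True
      define s where "s = 8 * sqrt (real t)"
      have "real u * real t / real m = (real u * sqrt (real t)) * sqrt (real t) / real m" by simp
      also have "\<dots> \<le> real m * sqrt (real t) / real m"
        by (intro divide_right_mono mult_right_mono) (use False in simp_all)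
      also have "\<dots> \<le> s" using m st by (simp add: s_def)
      finally have s: "real u * real t / real m \<le> s" .
      show ?thesis
      proof (rule heavy[OF u s])
        fix c V assume "card V = u" "\<not> regular_on m t (supp \<circ> c) V"
        then show "u \<le> card {j. j < m \<and> s < real (row_size (supp \<circ> c) V j)}"
          using False by (simp add: regular_on_def s_def)
      qed (use t u k L False True in \<open>intro sparse_exponent_le; simp add: s_def\<close>)
    next
      \<comment> \<open>Fewer than 8 sqrt t columns cannot give a row more than 8 sqrt t ones, so
        such sets are regular with certainty.\<close>
      case small: False
      have "regular_on m t S V" if V: "V \<subseteq> {..<k}" "card V = u" for S V
      proof -
        have "finite V" using V finite_subset by blast
        then have "\<not> 8 * sqrt (real t) < real (row_size S V j)" for j
          using row_size_le[of V S j] V small by linarith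
        then have E: "{j. j < m \<and> 8 * sqrt (real t) < real (row_size S V j)} = {}" by blast
        show ?thesis unfolding regular_on_def E using False V u by simp
      qed
      then have "?E = {}" by blast
      then show ?thesis by (simp only: measure_empty exp_ge_zero)
    qed
  qed
qed

definition regular :: "nat \<Rightarrow> nat \<Rightarrow> nat \<Rightarrow> (nat \<Rightarrow> nat set) \<Rightarrow> bool" where
  "regular m k t S \<longleftrightarrow> (\<forall>V\<subseteq>{..<k}. V \<noteq> {} \<longrightarrow> card V \<le> m \<longrightarrow> regular_on m t S V)"

text \<open>The \<open>- real u\<close> in the exponent makes the sum over sizes geometric: exp(-u)
  \<le> 2^(-u), and these sum to less than 1 from u = 1 on.\<close>

lemma prob_regular_ge:
  assumes t: "t > 0" "t \<le> m" and k: "k > 0"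
    and L: "ln (exp 1 * real k / real m) \<le> sqrt (real t)"
  shows "measure_pmf.prob (random_columns m k t) {c. regular m k t (supp \<circ> c)} \<ge> 1 - exp (- real t)"
proof -
  let ?P = "random_columns m k t"
  let ?E = "\<lambda>u. {c. \<exists>V\<subseteq>{..<k}. card V = u \<and> \<not> regular_on m t (supp \<circ> c) V}"
  define A where "A = {c. regular m k t (supp \<circ> c)}"
  have "- A \<subseteq> (\<Union>u\<in>{1..m}. ?E u)"
  proof
    fix c assume "c \<in> - A"
    then obtain V where V: "V \<subseteq> {..<k}" "V \<noteq> {}" "card V \<le> m" "\<not> regular_on m t (supp \<circ> c) V"
      by (auto simp: A_def regular_def)
    then have "finite V" using finite_subset by blast
    then have "card V \<in> {1..m}" using V by (simp add: Suc_leI card_gt_0_iff)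
    then show "c \<in> (\<Union>u\<in>{1..m}. ?E u)" using V by blast
  qed
  then have "measure_pmf.prob ?P (- A) \<le> measure_pmf.prob ?P (\<Union>u\<in>{1..m}. ?E u)"
    by (intro measure_pmf.finite_measure_mono) auto
  also have "\<dots> \<le> (\<Sum>u\<in>{1..m}. measure_pmf.prob ?P (?E u))"
    by (intro measure_pmf.finite_measure_subadditive_finite) auto
  also have "\<dots> \<le> (\<Sum>u\<in>{1..m}. exp (- real t) * (1 / 2) ^ u)"
  proof (rule sum_mono)
    fix u assume u: "u \<in> {1..m}"
    have "exp (1::real) \<ge> 2" using exp_ge_add_one_self[of 1] by simp
    then have "exp (-1 :: real) \<le> 1 / 2" by (simp add: exp_minus field_simps)
    then have "exp (-1 :: real) ^ u \<le> (1 / 2) ^ u" by (intro power_mono) auto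
    moreover have "exp (- real t - real u) = exp (- real t) * exp (-1) ^ u"
      by (simp add: exp_of_nat_mult[symmetric] exp_add[symmetric])
    ultimately have "exp (- real t - real u) \<le> exp (- real t) * (1 / 2) ^ u" by simp
    then show "measure_pmf.prob ?P (?E u) \<le> exp (- real t) * (1 / 2) ^ u"
      using prob_irregular_le[OF t k _ _ L, of u] u by simp
  qed
  also have "\<dots> = exp (- real t) * (\<Sum>u\<in>{1..m}. (1 / 2) ^ u)" by (simp only: sum_distrib_left)
  also have "(\<Sum>u\<in>{1..m}. (1 / 2 :: real) ^ u) = 1 - (1 / 2) ^ m" by (induction m) auto
  also have "exp (- real t) * (1 - (1 / 2) ^ m) \<le> exp (- real t)" by simp
  finally have "measure_pmf.prob ?P (- A) \<le> exp (- real t)" .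
  moreover have "measure_pmf.prob ?P (- A) = 1 - measure_pmf.prob ?P A"
    using measure_pmf.prob_compl[of A ?P] by (simp add: Compl_eq_Diff_UNIV)
  ultimately show ?thesis unfolding A_def by linarith
qed

section \<open>Colouring a regular matrix\<close>

text \<open>Serves the case of bounded \<open>t\<close>. The columns of \<open>V\<close> hold at
  most \<open>t * card V\<close> ones, so fewer than \<open>card V\<close> rows have more than
  \<open>t\<close> of them.\<close>

lemma beck_fiala_uniform:
  fixes S :: "'a \<Rightarrow> nat set"
  assumes U: "finite U" and S: "\<And>i. i \<in> U \<Longrightarrow> S i \<subseteq> {..<m} \<and> card (S i) = t"
  shows "\<exists>\<chi>. (\<forall>i\<in>U. \<chi> i \<in> {-1, 1}) \<and> (\<forall>j\<in>{..<m}. \<bar>row_sum S U \<chi> j\<bar> \<le> 2 * real t)"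
proof -
  have "card {j\<in>{..<m}. real (row_size S V j) > real t} < card V" if V: "V \<subseteq> U" "V \<noteq> {}" for V
  proof -
    define B where "B = {j\<in>{..<m}. real (row_size S V j) > real t}"
    have finV: "finite V" using V U finite_subset by blast
    have finB: "finite B" by (rule finite_subset[of _ "{..<m}"]) (auto simp: B_def)
    have "(\<Sum>j\<in>B. t + 1) \<le> (\<Sum>j\<in>B. row_size S V j)"
      by (intro sum_mono) (auto simp: B_def)
    also have "\<dots> = (\<Sum>i\<in>V. card (S i \<inter> B))" using finV finB by (rule sum_row_size)
    also have "\<dots> \<le> (\<Sum>i\<in>V. t)"
    proof (rule sum_mono)
      fix i assume "i \<in> V"
      then have "S i \<subseteq> {..<m}" "card (S i) = t" using S V by auto
      then show "card (S i \<inter> B) \<le> t" using card_mono[of "S i" "S i \<inter> B"] finite_subset by auto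
    qed
    finally have "card B * (t + 1) \<le> card V * t" by simp
    moreover have "card V * t < card V * (t + 1)" using finV V by (simp add: card_gt_0_iff)
    ultimately have "card B * (t + 1) < card V * (t + 1)" by linarith
    then have "card B < card V" by (simp only: mult_less_cancel2)
    then show ?thesis unfolding B_def .
  qed
  then have "\<exists>\<chi>. (\<forall>i\<in>U. \<chi> i \<in> {-1, 1}) \<and>
    (\<forall>j\<in>{..<m}. \<bar>row_sum S U \<chi> j - row_sum S U (\<lambda>_. 0) j\<bar> \<le> 2 * real t)"
    using U by (intro beck_fiala) auto
  then show ?thesis by (simp add: row_sum_def)
qed

text \<open>(79/80)^8 exceeds 0.9, the largest fraction of columns that a partial colouring leaves
  uncoloured.\<close>

lemma eighth_root_shrink:
  fixes x y :: real
  assumes "0 \<le> x" "0 \<le> y" "x \<le> 0.9 * y"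
  shows "sqrt (sqrt (sqrt x)) \<le> 79 / 80 * sqrt (sqrt (sqrt y))"
proof -
  have "0.9 \<le> (((79 / 80)\<^sup>2)\<^sup>2)\<^sup>2 * (1 :: real)" by (simp add: power2_eq_square)
  then have "x \<le> (((79 / 80)\<^sup>2)\<^sup>2)\<^sup>2 * y"
    using assms mult_right_mono[of "0.9" "(((79 / 80)\<^sup>2)\<^sup>2)\<^sup>2" y] by linarith
  then have "sqrt (sqrt (sqrt x)) \<le> sqrt (sqrt (sqrt ((((79 / 80)\<^sup>2)\<^sup>2)\<^sup>2 * y)))"
    by simp
  also have "\<dots> = 79 / 80 * sqrt (sqrt (sqrt y))"
    by (simp only: real_sqrt_mult real_sqrt_abs abs_power2)
  finally show ?thesis .
qed

text \<open>With z = x^(1/8) we have sqrt x = z^4, and the logarithm is at most 16 / z^2 because 160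
  \<le> 4^4, so z^2 survives under the root. The constant is 8 * 16 * 8 = 32^2.\<close>

lemma partial_colouring_error_le:
  fixes t x :: real
  assumes t: "t \<ge> 0" and x: "0 < x" "x \<le> 1"
  shows "sqrt (8 * ln (160 / x) * (8 * t * sqrt x)) \<le> 32 * sqrt t * sqrt (sqrt (sqrt x))"
proof -
  define z where "z = sqrt (sqrt (sqrt x))"
  have z: "z > 0" "sqrt x = z ^ 4" "x = z ^ 8"
  proof -
    show "z > 0" using x by (simp add: z_def)
    have "z\<^sup>2 = sqrt (sqrt x)" using x by (simp add: z_def)
    then have "z ^ 4 = (sqrt (sqrt x))\<^sup>2" by (metis power_even_eq[of z 2] mult_2 numeral_Bit0)
    then show 4: "sqrt x = z ^ 4" using x by simp
    then have "z ^ 8 = (sqrt x)\<^sup>2" by (simp add: power_mult[symmetric])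
    then show "x = z ^ 8" using x by simp
  qed
  have "160 / x \<le> (4 / z\<^sup>2) ^ 4" using z by (simp add: z(3) power_divide power_mult[symmetric] divide_right_mono)
  then have "ln (160 / x) \<le> ln ((4 / z\<^sup>2) ^ 4)" using x by (intro ln_mono) auto
  also have "\<dots> = 4 * ln (4 / z\<^sup>2)" using z by (simp add: ln_realpow)
  also have "\<dots> \<le> 4 * (4 / z\<^sup>2)" using z ln_le_minus_one[of "4 / z\<^sup>2"] by simp
  finally have "8 * ln (160 / x) * (8 * t * sqrt x) \<le> 8 * (16 / z\<^sup>2) * (8 * t * sqrt x)"
    using t x by (intro mult_right_mono) auto
  also have "\<dots> = 1024 * t * z\<^sup>2" unfolding z(2) using z(1) by (simp add: field_simps power2_eq_square power4_eq_xxxx)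
  also have "\<dots> = (32 * sqrt t * z)\<^sup>2" using t by (simp add: power_mult_distrib)
  finally have "sqrt (8 * ln (160 / x) * (8 * t * sqrt x)) \<le> 32 * sqrt t * z"
    using t z by (intro real_le_lsqrt) auto
  then show ?thesis by (simp add: z_def)
qed

text \<open>Induction on the size u with potential 2560 sqrt t (u/m)^(1/8): in units of sqrt t
  (u/m)^(1/8), a stage costs 32 and the remaining columns at most 2560 * 79/80 = 2528, so 2560 = 32
  * 80 reproduces itself. The sparse remainder costs 16 sqrt t, once.\<close>

lemma hereditary_discrepancy_le:
  assumes m: "m > 0" and t: "t \<ge> 100"
    and t_large: "2 * ln (real t) / sqrt (sqrt (real t)) + 3 / real t \<le> 1 / 20"
    and S: "\<And>i. i < k \<Longrightarrow> S i \<subseteq> {..<m} \<and> card (S i) = t"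
    and reg: "regular m k t S" and U: "U \<subseteq> {..<k}" "card U \<le> m" and tm: "t \<le> m"
  shows "\<exists>\<chi>. (\<forall>i\<in>U. \<chi> i \<in> {-1, 1}) \<and> (\<forall>j\<in>{..<m}. \<bar>row_sum S U \<chi> j\<bar> \<le>
    16 * sqrt (real t) + 2560 * sqrt (real t) * sqrt (sqrt (sqrt (real (card U) / real m))))"
  using U
proof (induction "card U" arbitrary: U rule: less_induct)
  case less
  define u where "u = real (card U)"
  define q where "q = sqrt (sqrt (real t))"
  have finU: "finite U" using less.prems finite_subset by blast
  have q: "q \<ge> 1" using t by (simp add: q_def)
  show ?case
  proof (cases "real m \<le> u * sqrt (real t)")
    case False
    have "card {j\<in>{..<m}. 8 * sqrt (real t) < real (row_size S V j)} < card V" if V: "V \<subseteq> U" "V \<noteq> {}" for V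
    proof -
      have "card V \<le> card U" using finU V by (intro card_mono)
      then have "real (card V) * sqrt (real t) \<le> u * sqrt (real t)"
        unfolding u_def by (intro mult_right_mono) auto
      then have "real (card V) * sqrt (real t) < real m" using False by linarith
      moreover have "regular_on m t S V"
        using reg V less.prems \<open>card V \<le> card U\<close> by (auto simp: regular_def)
      ultimately show ?thesis by (simp add: regular_on_def)
    qed
    then have "\<exists>\<chi>. (\<forall>i\<in>U. \<chi> i \<in> {-1, 1}) \<and>
      (\<forall>j\<in>{..<m}. \<bar>row_sum S U \<chi> j - row_sum S U (\<lambda>_. 0) j\<bar> \<le> 2 * (8 * sqrt (real t)))"
      using finU by (intro beck_fiala) auto
    then obtain \<chi> where \<chi>: "\<forall>i\<in>U. \<chi> i \<in> {-1, 1}" "\<forall>j\<in>{..<m}. \<bar>row_sum S U \<chi> j\<bar> \<le> 16 * sqrt (real t)"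
      by (auto simp: row_sum_def)
    moreover have "2560 * sqrt (real t) * sqrt (sqrt (sqrt (real (card U) / real m))) \<ge> 0" by simp
    ultimately show ?thesis by (intro exI[of _ \<chi>]) (meson add_increasing2 order.trans)
  next
    case True
    define s where "s = 8 * real t * sqrt (u / real m)"
    \<comment> \<open>Chosen so that \<open>m * exp (- l)\<close> is exactly u/160, the bound
      \<open>few\<close> of \<open>partial_colouring\<close>.\<close>
    define l where "l = ln (160 * real m / u)"
    define B where "B = {j. j < m \<and> s < real (row_size S U j)}"
    \<comment> \<open>By \<open>t \<le> m\<close> a dense set has at least sqrt t \<ge> 10 columns,
      as \<open>partial_colouring\<close> demands.\<close>
    have "real t \<le> u * sqrt (real t)" using True tm by linarith
    then have "sqrt (real t) * sqrt (real t) \<le> u * sqrt (real t)" by simp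
    then have "sqrt (real t) \<le> u" by (rule mult_right_le_imp_le) (use t in simp)
    moreover have "sqrt (real t) \<ge> 10" using t by (intro real_le_rsqrt) auto
    ultimately have u10: "u \<ge> 10" by linarith
    have um: "u \<le> real m" using less.prems by (simp add: u_def)
    have finB: "finite B" "B \<subseteq> {..<m}" by (auto simp: B_def)
    have "U \<noteq> {}" using u10 by (auto simp: u_def)
    then have "regular_on m t S U" using reg less.prems by (auto simp: regular_def)
    then have cardB: "real (card B) \<le> u / q"
      using True by (simp add: regular_on_def u_def q_def B_def s_def)
    have "u / q \<le> u" using q u10 by (simp add: divide_le_eq)
    have bad: "(\<Sum>j\<in>B. ln (2 * real (row_size S U j) + 1)) \<le> u / 20"
    proof -
      \<comment> \<open>The tangent of the logarithm at $t^2$ replaces concavity, since only the sum of the row sizes is known.\<close>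
      have ln_le: "ln (2 * real n + 1) \<le> 2 * ln (real t) + (2 * real n + 1) / (real t)\<^sup>2" for n
      proof -
        have "2 * real n + 1 = (real t)\<^sup>2 * ((2 * real n + 1) / (real t)\<^sup>2)" using t by simp
        then have "ln (2 * real n + 1) = ln ((real t)\<^sup>2) + ln ((2 * real n + 1) / (real t)\<^sup>2)"
          using t ln_mult[of "(real t)\<^sup>2" "(2 * real n + 1) / (real t)\<^sup>2"] by simp
        also have "ln ((2 * real n + 1) / (real t)\<^sup>2) \<le> (2 * real n + 1) / (real t)\<^sup>2"
          using t ln_le_minus_one[of "(2 * real n + 1) / (real t)\<^sup>2"] by simp
        finally show ?thesis using t by (simp add: ln_realpow)
      qed
      have "(\<Sum>j\<in>B. row_size S U j) = (\<Sum>i\<in>U. card (S i \<inter> B))" using finU finB(1) by (rule sum_row_size)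
      also have "\<dots> \<le> (\<Sum>i\<in>U. t)"
      proof (rule sum_mono)
        fix i assume "i \<in> U"
        then have "S i \<subseteq> {..<m}" "card (S i) = t" using S less.prems by auto
        then show "card (S i \<inter> B) \<le> t" using card_mono[of "S i" "S i \<inter> B"] finite_subset by auto
      qed
      finally have "real (\<Sum>j\<in>B. row_size S U j) \<le> real (card U * t)" by (simp only: of_nat_le_iff sum_constant of_nat_id)
      then have total: "(\<Sum>j\<in>B. real (row_size S U j)) \<le> u * real t" by (simp add: u_def)
      have "(\<Sum>j\<in>B. ln (2 * real (row_size S U j) + 1)) \<le>
        (\<Sum>j\<in>B. 2 * ln (real t) + (2 * real (row_size S U j) + 1) / (real t)\<^sup>2)"
        by (intro sum_mono ln_le)
      also have "\<dots> = real (card B) * (2 * ln (real t)) + (2 * (\<Sum>j\<in>B. real (row_size S U j)) + real (card B)) / (real t)\<^sup>2"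
        by (simp add: sum.distrib sum_divide_distrib[symmetric] sum_distrib_left[symmetric])
      also have "\<dots> \<le> u / q * (2 * ln (real t)) + (2 * (u * real t) + u) / (real t)\<^sup>2"
        using total cardB \<open>u / q \<le> u\<close> t by (intro add_mono mult_right_mono divide_right_mono) auto
      also have "\<dots> \<le> u / q * (2 * ln (real t)) + (2 * (u * real t) + u * real t) / (real t)\<^sup>2"
        using t u10 by (intro add_left_mono divide_right_mono add_mono) auto
      also have "\<dots> = u * (2 * ln (real t) / q + 3 / real t)"
        using t by (simp add: field_simps power2_eq_square)
      also have "\<dots> \<le> u * (1 / 20)" using t_large u10 unfolding q_def by (intro mult_left_mono) auto
      finally show ?thesis by simp
    qed
    have "exp 1 \<le> 160 * real m / u"
    proof -
      have "exp 1 * u \<le> 160 * real m" using e_less_272 um u10 mult_mono[of "exp 1" 160 u "real m"] by simp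
      then show ?thesis using u10 by (simp add: field_simps)
    qed
    then have l: "l \<ge> 1" "exp (- l) = u / (160 * real m)"
      using u10 m by (auto simp: l_def ln_ge_iff exp_minus)
    have "\<exists>y. (\<forall>i\<in>U. y i \<in> {-1, 0, 1}) \<and> real (card {i\<in>U. y i \<noteq> 0}) \<ge> real (card U) / 10 \<and>
      (\<forall>j\<in>{..<m}-B. \<bar>row_sum S U y j\<bar> \<le> sqrt (8 * l * s)) \<and> (\<forall>j\<in>B. row_sum S U y j = 0)"
    proof (rule partial_colouring)
      show "card U \<ge> 10" using u10 by (simp add: u_def)
      show "s > 0" using t u10 m by (simp add: s_def)
      show "real (card {..<m}) * exp (- l) \<le> real (card U) / 160" using m by (simp add: l u_def)
      show "real (row_size S U j) \<le> s" if "j \<in> {..<m} - B" for j using that by (auto simp: B_def)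
    qed (use finU finB l bad in \<open>auto simp: u_def\<close>)
    then obtain y where y: "\<And>i. i \<in> U \<Longrightarrow> y i \<in> {-1, 0, 1}" "real (card {i\<in>U. y i \<noteq> 0}) \<ge> u / 10"
      "\<forall>j\<in>{..<m}-B. \<bar>row_sum S U y j\<bar> \<le> sqrt (8 * l * s)" "\<forall>j\<in>B. row_sum S U y j = 0"
      unfolding u_def by blast
    define V where "V = {i\<in>U. y i = 0}"
    have V: "V \<subseteq> U" "finite V" using finU by (auto simp: V_def)
    have "card U = card V + card {i\<in>U. y i \<noteq> 0}"
      using finU by (subst card_Un_disjoint[symmetric]) (auto simp: V_def intro: arg_cong[of _ _ card])
    then have cardV: "real (card V) \<le> 0.9 * u" using y(2) by (simp add: u_def)
    then have "card V < card U" using u10 by (simp add: u_def)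
    moreover have "V \<subseteq> {..<k}" "card V \<le> m" using V less.prems \<open>card V < card U\<close> by auto
    ultimately obtain \<psi> where \<psi>: "\<forall>i\<in>V. \<psi> i \<in> {-1, 1}" "\<forall>j\<in>{..<m}. \<bar>row_sum S V \<psi> j\<bar> \<le>
        16 * sqrt (real t) + 2560 * sqrt (real t) * sqrt (sqrt (sqrt (real (card V) / real m)))"
      using less.hyps by blast
    define \<chi> where "\<chi> i = (if i \<in> V then \<psi> i else y i)" for i
    have sum_eq: "row_sum S U \<chi> j = row_sum S U y j + row_sum S V \<psi> j" for j
    proof -
      have "row_sum S (U - V) \<chi> j = row_sum S (U - V) y j" "row_sum S V \<chi> j = row_sum S V \<psi> j" "row_sum S V y j = 0"
        by (auto simp: row_sum_def \<chi>_def V_def intro!: sum.cong)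
      then show ?thesis
        unfolding row_sum_def sum.subset_diff[OF V(1) finU] by simp
    qed
    have "\<bar>row_sum S U \<chi> j\<bar> \<le> 16 * sqrt (real t) + 2560 * sqrt (real t) * sqrt (sqrt (sqrt (u / real m)))"
      if j: "j < m" for j
    proof -
      have "u / real m > 0" "u / real m \<le> 1" using um u10 m by auto
      then have "sqrt (8 * ln (160 / (u / real m)) * (8 * real t * sqrt (u / real m))) \<le>
        32 * sqrt (real t) * sqrt (sqrt (sqrt (u / real m)))"
        by (intro partial_colouring_error_le) auto
      then have stage: "sqrt (8 * l * s) \<le> 32 * sqrt (real t) * sqrt (sqrt (sqrt (u / real m)))"
        by (simp add: l_def s_def)
      have "\<bar>row_sum S U y j\<bar> \<le> sqrt (8 * l * s)"
        using y(3,4) j l t u10 by (cases "j \<in> B") (auto simp: s_def)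
      with stage have "\<bar>row_sum S U y j\<bar> \<le> 32 * sqrt (real t) * sqrt (sqrt (sqrt (u / real m)))" by linarith
      moreover have "sqrt (sqrt (sqrt (real (card V) / real m))) \<le> 79 / 80 * sqrt (sqrt (sqrt (u / real m)))"
        using cardV m u10 by (intro eighth_root_shrink) (auto simp: field_simps)
      then have "2560 * sqrt (real t) * sqrt (sqrt (sqrt (real (card V) / real m))) \<le>
        2560 * sqrt (real t) * (79 / 80 * sqrt (sqrt (sqrt (u / real m))))"
        by (intro mult_left_mono) auto
      moreover have "2560 * sqrt (real t) * (79 / 80 * sqrt (sqrt (sqrt (u / real m)))) =
        2528 * sqrt (real t) * sqrt (sqrt (sqrt (u / real m)))" by simp
      moreover have "\<bar>row_sum S V \<psi> j\<bar> \<le> 16 * sqrt (real t) + 2560 * sqrt (real t) * sqrt (sqrt (sqrt (real (card V) / real m)))"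
        using \<psi>(2) j by simp
      ultimately show ?thesis unfolding sum_eq by linarith
    qed
    moreover have "\<chi> i \<in> {-1, 1}" if "i \<in> U" for i
      using \<psi>(1) y(1)[OF that] that by (auto simp: \<chi>_def V_def)
    ultimately show ?thesis unfolding u_def by (intro exI[of _ \<chi>]) auto
  qed
qed

lemma regular_discrepancy_le:
  assumes m: "m > 0" and t: "t \<ge> 100"
    and t_large: "2 * ln (real t) / sqrt (sqrt (real t)) + 3 / real t \<le> 1 / 20"
    and S: "\<And>i. i < k \<Longrightarrow> S i \<subseteq> {..<m} \<and> card (S i) = t"
    and reg: "regular m k t S" and tm: "t \<le> m"
  shows "\<exists>\<chi>. (\<forall>i<k. \<chi> i \<in> {-1, 1}) \<and> (\<forall>j<m. \<bar>row_sum S {..<k} \<chi> j\<bar> \<le> 5153 * sqrt (real t))"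
proof -
  \<comment> \<open>16 + 2560 = 2576, as the eighth root is at most 1. Rounding doubles this and
    adds 1, hence 5153 = 2 * 2576 + 1.\<close>
  define D where "D = 2576 * sqrt (real t)"
  have her: "\<exists>\<chi>. (\<forall>i\<in>U. \<chi> i \<in> {-1, 1}) \<and> (\<forall>j\<in>{..<m}. \<bar>row_sum S U \<chi> j\<bar> \<le> D)"
    if U: "U \<subseteq> {..<k}" "card U \<le> m" for U
  proof -
    have "real (card U) / real m \<le> 1" using U m by simp
    then have "sqrt (sqrt (sqrt (real (card U) / real m))) \<le> 1" by simp
    then have "2560 * sqrt (real t) * sqrt (sqrt (sqrt (real (card U) / real m))) \<le> 2560 * sqrt (real t) * 1"
      by (intro mult_left_mono) auto
    then have "16 * sqrt (real t) + 2560 * sqrt (real t) * sqrt (sqrt (sqrt (real (card U) / real m))) \<le> D"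
      unfolding D_def by linarith
    with hereditary_discrepancy_le[OF m t t_large S reg U tm] show ?thesis
      by (meson order.trans)
  qed
  \<comment> \<open>Floating from the zero colouring keeps every row sum at 0, so only the rounding
    on \<open>W\<close> contributes to the final row sums.\<close>
  have "\<exists>x. (\<forall>i\<in>{..<k}. \<bar>x i\<bar> \<le> 1) \<and> card {i\<in>{..<k}. \<bar>x i\<bar> < 1} \<le> card {..<m} \<and>
    (\<forall>j\<in>{..<m}. (\<Sum>i<k. of_bool (j \<in> S i) * x i) = (\<Sum>i<k. of_bool (j \<in> S i) * (0 :: real)))"
    by (rule floating_colours[where x = "\<lambda>_. 0"]) auto
  then obtain x where x: "\<And>i. i < k \<Longrightarrow> \<bar>x i\<bar> \<le> (1::real)" "card {i\<in>{..<k}. \<bar>x i\<bar> < 1} \<le> m"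
    "\<And>j. j < m \<Longrightarrow> row_sum S {..<k} x j = 0"
    by (auto simp: row_sum_def)
  define W where "W = {i\<in>{..<k}. \<bar>x i\<bar> < 1}"
  have W: "finite W" "W \<subseteq> {..<k}" "card W \<le> m" using x(2) by (auto simp: W_def)
  have "\<exists>\<chi>. (\<forall>i\<in>W. \<chi> i \<in> {-1, 1}) \<and> (\<forall>j\<in>{..<m}. \<bar>row_sum S W \<chi> j - row_sum S W x j\<bar> \<le> 2 * D + 1)"
  proof (rule linear_discrepancy_le_hereditary[OF W(1)])
    show "\<exists>\<chi>. (\<forall>i\<in>U. \<chi> i \<in> {-1, 1}) \<and> (\<forall>j\<in>{..<m}. \<bar>row_sum S U \<chi> j\<bar> \<le> D)" if "U \<subseteq> W" for U
    proof (rule her)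
      show "U \<subseteq> {..<k}" using that W by blast
      show "card U \<le> m" using card_mono[OF W(1) that] W(3) by linarith
    qed
  qed (use x W in \<open>auto simp: D_def W_def\<close>)
  then obtain \<psi> where \<psi>: "\<forall>i\<in>W. \<psi> i \<in> {-1, 1}"
    "\<forall>j\<in>{..<m}. \<bar>row_sum S W \<psi> j - row_sum S W x j\<bar> \<le> 2 * D + 1" by blast
  define \<chi> where "\<chi> i = (if i \<in> W then \<psi> i else x i)" for i
  have "\<chi> i \<in> {-1, 1}" if "i < k" for i
  proof (cases "i \<in> W")
    case False
    then have "\<bar>x i\<bar> = 1" using x(1)[OF that] that by (simp add: W_def)
    then show ?thesis using False by (auto simp: \<chi>_def abs_if split: if_splits)
  qed (use \<psi> in \<open>simp add: \<chi>_def\<close>)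
  moreover have "\<bar>row_sum S {..<k} \<chi> j\<bar> \<le> 5153 * sqrt (real t)" if "j < m" for j
  proof -
    have "row_sum S ({..<k} - W) \<chi> j = row_sum S ({..<k} - W) x j" "row_sum S W \<chi> j = row_sum S W \<psi> j"
      by (auto simp: row_sum_def \<chi>_def intro!: sum.cong)
    then have "row_sum S {..<k} \<chi> j - row_sum S {..<k} x j = row_sum S W \<psi> j - row_sum S W x j"
      unfolding row_sum_def sum.subset_diff[OF W(2) finite_lessThan] by simp
    then have "\<bar>row_sum S {..<k} \<chi> j\<bar> \<le> 2 * D + 1" using x(3)[OF that] \<psi>(2) that by simp
    moreover have "sqrt (real t) \<ge> 1" using t by simp
    ultimately show ?thesis unfolding D_def by linarith
  qed
  ultimately show ?thesis by blast
qed

section \<open>From set systems back to matrices, and the choice of constants\<close>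

lemma disc_le:
  assumes "dim_row A > 0" "\<And>i. i < dim_col A \<Longrightarrow> \<chi> i \<in> {-1, 1}"
    and "\<And>j. j < dim_row A \<Longrightarrow> \<bar>\<Sum>i<dim_col A. A $$ (j, i) * \<chi> i\<bar> \<le> b"
  shows "disc A \<le> b"
proof -
  define v where "v = vec (dim_col A) \<chi>"
  have v: "v \<in> sign_vecs (dim_col A)" using assms(2) by (auto simp: v_def sign_vecs_def)
  have "disc A \<le> Max ((\<lambda>j. \<bar>row A j \<bullet> v\<bar>) ` {..<dim_row A})"
    unfolding disc_def using v by (intro Min_le) (auto simp: finite_sign_vecs)
  also have "\<dots> \<le> b"
  proof (intro Max.boundedI)
    fix z assume "z \<in> (\<lambda>j. \<bar>row A j \<bullet> v\<bar>) ` {..<dim_row A}"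
    then obtain j where j: "j < dim_row A" "z = \<bar>row A j \<bullet> v\<bar>" by auto
    have "row A j \<bullet> v = (\<Sum>i<dim_col A. A $$ (j, i) * \<chi> i)"
      using j by (auto simp: scalar_prod_def v_def atLeast0LessThan intro!: sum.cong)
    then show "z \<le> b" using assms(3) j by simp
  qed (use assms(1) in auto)
  finally show ?thesis .
qed

lemma disc_columns_le:
  assumes m: "m > 0" and c: "\<And>i. i < k \<Longrightarrow> c i \<in> binary_vecs m t"
    and \<chi>: "\<And>i. i < k \<Longrightarrow> \<chi> i \<in> {-1, 1}"
    and b: "\<And>j. j < m \<Longrightarrow> \<bar>row_sum (supp \<circ> c) {..<k} \<chi> j\<bar> \<le> b"
  shows "disc (mat_of_cols m (map c [0..<k])) \<le> b"
proof (rule disc_le[of _ \<chi>])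
  fix j assume "j < dim_row (mat_of_cols m (map c [0..<k]))"
  then have j: "j < m" by simp
  have "(\<Sum>i<k. mat_of_cols m (map c [0..<k]) $$ (j, i) * \<chi> i) = row_sum (supp \<circ> c) {..<k} \<chi> j"
    unfolding row_sum_def
  proof (rule sum.cong[OF refl])
    fix i assume "i \<in> {..<k}"
    then have i: "i < k" by simp
    then have "c i $ j = of_bool (j \<in> supp (c i))"
      using c[OF i] j by (auto simp: binary_vecs_def supp_def)
    then show "mat_of_cols m (map c [0..<k]) $$ (j, i) * \<chi> i = of_bool (j \<in> (supp \<circ> c) i) * \<chi> i"
      using i j by (simp add: mat_of_cols_index)
  qed
  then show "\<bar>\<Sum>i<dim_col (mat_of_cols m (map c [0..<k])). mat_of_cols m (map c [0..<k]) $$ (j, i) * \<chi> i\<bar> \<le> b"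
    using b[OF j] by simp
qed (use m \<chi> in auto)

theorem theorem3:
  shows "\<exists>C\<^sub>0 C\<^sub>1 :: real. C\<^sub>0 > 0 \<and> C\<^sub>1 > 0 \<and>
    (\<forall>m k t :: nat. m > 0 \<longrightarrow> k > 0 \<longrightarrow> t > 0 \<longrightarrow> t \<le> m \<longrightarrow>
       real t \<ge> C\<^sub>0 * (ln (exp 1 * real k / real m))\<^sup>2 \<longrightarrow>
       measure_pmf.prob (random_matrix m k t) {A. disc A \<le> C\<^sub>1 * sqrt (real t)}
         \<ge> 1 - exp (- real t))"
proof -
  \<comment> \<open>The size of \<open>t\<close> from which the heavy rows fit into the pigeonhole
    budget of \<open>hereditary_discrepancy_le\<close>.\<close>
  have "eventually (\<lambda>t::nat. 2 * ln (real t) / sqrt (sqrt (real t)) + 3 / real t \<le> 1 / 20) at_top"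
    by real_asymp
  then obtain N where N: "\<And>t. t \<ge> N \<Longrightarrow> 2 * ln (real t) / sqrt (sqrt (real t)) + 3 / real t \<le> 1 / 20"
    unfolding eventually_at_top_linorder by blast
  define T where "T = max N 100"
  \<comment> \<open>The summand \<open>2 * real T\<close> serves \<open>t < T\<close>, where the
    Beck-Fiala bound 2 t is at most C \<le> C sqrt t.\<close>
  define C where "C = 5153 + 2 * real T"
  have "measure_pmf.prob (random_matrix m k t) {A. disc A \<le> C * sqrt (real t)} \<ge> 1 - exp (- real t)"
    if m: "m > 0" and k: "k > 0" and t: "t > 0" "t \<le> m"
      and L: "real t \<ge> 1 * (ln (exp 1 * real k / real m))\<^sup>2" for m k t :: nat
  proof -
    let ?P = "random_columns m k t"
    have st: "sqrt (real t) \<ge> 1" using t by simp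
    have "ln (exp 1 * real k / real m) \<le> sqrt (real t)" using L by (intro real_le_rsqrt) simp
    then have "1 - exp (- real t) \<le> measure_pmf.prob ?P {c. regular m k t (supp \<circ> c)}"
      using t k by (intro prob_regular_ge)
    also have "\<dots> \<le> measure_pmf.prob ?P ((\<lambda>c. mat_of_cols m (map c [0..<k])) -` {A. disc A \<le> C * sqrt (real t)})"
    \<comment> \<open>Regularity says nothing about column weights; restricting to the support adds
      that every column has exactly \<open>t\<close> ones.\<close>
    proof (rule measure_pmf.finite_measure_mono_AE)
      show "AE c in ?P. c \<in> {c. regular m k t (supp \<circ> c)} \<longrightarrow>
        c \<in> (\<lambda>c. mat_of_cols m (map c [0..<k])) -` {A. disc A \<le> C * sqrt (real t)}"
      proof (rule AE_pmfI, rule impI)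
        fix c assume "c \<in> set_pmf ?P" and reg: "c \<in> {c. regular m k t (supp \<circ> c)}"
        then have c: "c i \<in> binary_vecs m t" if "i < k" for i
          using that set_pmf_of_set[OF binary_vecs_nonempty[OF t(2)] finite_binary_vecs]
          by (auto simp: set_Pi_pmf PiE_dflt_def)
        then have S: "(supp \<circ> c) i \<subseteq> {..<m} \<and> card ((supp \<circ> c) i) = t" if "i < k" for i
          using bij_betwE[OF bij_betw_supp] that by fastforce
        have "\<exists>\<chi>. (\<forall>i<k. \<chi> i \<in> {-1, 1}) \<and> (\<forall>j<m. \<bar>row_sum (supp \<circ> c) {..<k} \<chi> j\<bar> \<le> C * sqrt (real t))"
        proof (cases "t \<ge> T")
          case True
          then have large: "t \<ge> 100" "2 * ln (real t) / sqrt (sqrt (real t)) + 3 / real t \<le> 1 / 20"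
            using N by (auto simp: T_def)
          have "regular m k t (supp \<circ> c)" using reg by simp
          from regular_discrepancy_le[OF m large S this t(2)]
          obtain \<chi> where \<chi>: "\<forall>i<k. \<chi> i \<in> {-1, 1}"
            "\<forall>j<m. \<bar>row_sum (supp \<circ> c) {..<k} \<chi> j\<bar> \<le> 5153 * sqrt (real t)"
            by blast
          moreover have "5153 * sqrt (real t) \<le> C * sqrt (real t)"
            by (intro mult_right_mono) (auto simp: C_def)
          ultimately show ?thesis by (meson order.trans)
        next
          case False
          have "\<exists>\<chi>. (\<forall>i\<in>{..<k}. \<chi> i \<in> {-1, 1}) \<and> (\<forall>j\<in>{..<m}. \<bar>row_sum (supp \<circ> c) {..<k} \<chi> j\<bar> \<le> 2 * real t)"
            using S by (intro beck_fiala_uniform) auto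
          moreover have "2 * real t \<le> C * sqrt (real t)"
          proof -
            have "2 * real t \<le> C * 1" using False by (simp add: C_def)
            also have "\<dots> \<le> C * sqrt (real t)" using st by (intro mult_left_mono) (auto simp: C_def)
            finally show ?thesis .
          qed
          ultimately show ?thesis by (metis lessThan_iff order.trans)
        qed
        then obtain \<chi> where "\<And>i. i < k \<Longrightarrow> \<chi> i \<in> {-1, 1}"
          "\<And>j. j < m \<Longrightarrow> \<bar>row_sum (supp \<circ> c) {..<k} \<chi> j\<bar> \<le> C * sqrt (real t)" by blast
        then have "disc (mat_of_cols m (map c [0..<k])) \<le> C * sqrt (real t)"
          using m c by (intro disc_columns_le)
        then show "c \<in> (\<lambda>c. mat_of_cols m (map c [0..<k])) -` {A. disc A \<le> C * sqrt (real t)}" by simp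
      qed
    qed simp
    finally show ?thesis by (simp add: random_matrix_def)
  qed
  moreover have "C > 0" by (simp add: C_def)
  ultimately show ?thesis by (intro exI[of _ 1] exI[of _ C]) auto
qed

end
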